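(* Let $A=(a_{i,j})$ and $B=(b_{i,j})$ be $m\times n$ matrices over a commutative ring with unity, $m\le n$. Write $R(x;z;A)=\sum_{l=0}^m r_l(z;A)x^l$ with $r_0(z;A)=1$ and $R(x;A)=\sum_{l=0}^m r_l(A)x^l$ with $r_0(A)=1$. Then $$R(x;z;A+B)=\sum_{s=0}^m\sum_{\bar\alpha\in Q_{s,m}}\sum_{\varphi\in\mathrm{Inj}(\{\bar\alpha\},N_n)}z^{|\varphi|}\Big(\prod_{i\in\{\bar\alpha\}}a_{i,\varphi(i)}\Big)x^sR\big(x;z;B[N_m\setminus\{\bar\alpha\}\,|\,\bar\varphi(N_n)]\big);$$ $$r_l(z;A+B)=\sum_{s=0}^l\sum_{\bar\alpha\in Q_{s,m}}\sum_{\varphi\in\mathrm{Inj}(\{\bar\alpha\},N_n)}z^{|\varphi|}\Big(\prod_{i\in\{\bar\alpha\}}a_{i,\varphi(i)}\Big)r_{l-s}\big(z;B[N_m\setminus\{\bar\alpha\}\,|\,\bar\varphi(N_n)]\big);$$ $$\mathrm{per}(z;A+B)=\sum_{s=0}^m\sum_{\bar\alpha\in Q_{s,m}}\sum_{\varphi\in\mathrm{Inj}(\{\bar\alpha\},N_n)}z^{|\varphi|}\Big(\prod_{i\in\{\bar\alpha\}}a_{i,\varphi(i)}\Big)\mathrm{per}\big(z;B[N_m\setminus\{\bar\alpha\}\,|\,\bar\varphi(N_n)]\big);$$ $$R(x;A+B)=\sum_{s=0}^m\sum_{\bar\alpha\in Q_{s,m},\,\bar\beta\in Q_{s,n}}\mathrm{per}(A[\bar\alpha|\bar\beta])\,x^sR(x;B(\bar\alpha|\bar\beta));$$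 $$r_l(A+B)=\sum_{s=0}^l\sum_{\bar\alpha\in Q_{s,m},\,\bar\beta\in Q_{s,n}}\mathrm{per}(A[\bar\alpha|\bar\beta])\,r_{l-s}(B(\bar\alpha|\bar\beta));$$ $$\mathrm{per}(A+B)=\sum_{s=0}^m\sum_{\bar\alpha\in Q_{s,m},\,\bar\beta\in Q_{s,n}}\mathrm{per}(A[\bar\alpha|\bar\beta])\,\mathrm{per}(B(\bar\alpha|\bar\beta)).$$
   Context: $N_n=\{1,\dots,n\}$; $Q_{s,m}$ is the set of strictly increasing sequences of length $s$ with entries in $N_m$ ($Q_{0,m}$ contains only the empty sequence), and $\{\bar\alpha\}$ is the set of entries of $\bar\alpha$. For $S\subseteq N_n$, $\mathrm{Inj}(S,N_n)$ is the set of injective maps $S\to N_n$; for $\varphi\in\mathrm{Inj}(S,N_n)$, $|\varphi|$ is the number of cycles of $\varphi$, i.e. the number of nonempty sets $C\subseteq S$ of the form $\{j,\varphi(j),\dots,\varphi^{p-1}(j)\}$ with $\varphi^p(j)=j$. For a $p\times q$ matrix $C=(c_{i,j})$, $p\le q$: $r_l(z;C)=\sum_{S\subseteq N_p,|S|=l}\sum_{\varphi\in\mathrm{Inj}(S,N_q)}z^{|\varphi|}\prod_{i\in S}c_{i,\varphi(i)}$, $R(x;z;C)=\sum_{l=0}^p r_l(z;C)x^l$, $\mathrm{per}(z;C)=r_p(z;C)$ (the cyclic permanent); the ordinary permanent of a square matrix is $\mathrm{per}$, the ordinary rook numbers are $r_l(C)=\sum_{\bar\alpha\in Q_{l,p},\bar\beta\in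 Q_{l,q}}\mathrm{per}(C[\bar\alpha|\bar\beta])$ and $R(x;C)=\sum_{l=0}^p r_l(C)x^l$; for a matrix with no rows these quantities ($R$, $r_0$, $\mathrm{per}$) equal $1$. $C[\bar\alpha|\bar\beta]$ is the submatrix with rows $\bar\alpha$ and columns $\bar\beta$, and $C(\bar\alpha|\bar\beta)$ is the submatrix obtained by deleting the rows in $\bar\alpha$ and the columns in $\bar\beta$. For a set $T$ of row indices and a sequence $(c_1,\dots,c_q)$ of column indices, $B[T\,|\,c_1,\dots,c_q]$ is the matrix formed by the rows of $B$ indexed by $T$ in increasing order whose $s$-th column is column $c_s$ of $B$, re-indexed by $1,2,\dots$ in rows and columns before computing cyclic quantities. For $S\subseteq N_n$ and $\varphi\in\mathrm{Inj}(S,N_n)$ define $\varphi^*:\varphi(S)\setminus S\to S\setminus\varphi(S)$: for $j\in\varphi(S)\setminus S$, $j_0=j$, $j_l=\varphi^{-1}(j_{l-1})$ while $j_{l-1}\in\varphi(S)$, and $\varphi^*(j)$ is the first $j_l$ in $S\setminus\varphi(S)$. For a sequence $(x_1,\dots,x_n)$, $\bar\varphi(x_1,\dots,x_n)=(y_j)_{j\in N_n\setminus S}$ in increasing order of $j$, with $y_j=x_j$ if $j\notin\varphi(S)$ and $y_j=x_{\varphi^*(j)}$ if $j\in\varphi(S)\setminus S$; $\bar\varphi(N_n)=\bar\varphi(1,\dots,n)$. *)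

theory Defs
  imports "Jordan_Normal_Form.Matrix" "HOL-Library.FuncSet" "HOL-Computational_Algebra.Polynomial"
begin

text \<open>
  Rows and columns are numbered from 0, so \<open>{0..<n}\<close> plays the role of
  \<open>{1,...,n}\<close>.  A polynomial in \<open>z\<close> is an element of \<open>'a poly\<close>; a polynomial in
  \<open>x\<close> and \<open>z\<close> is an element of \<open>'a poly poly\<close>, where \<open>x\<close> is the outer and \<open>z\<close> the
  inner indeterminate, so that \<open>c * z^k * x^l\<close> is \<open>monom (monom c k) l\<close>.
\<close>

definition incr_seqs :: "nat \<Rightarrow> nat \<Rightarrow> nat list set" where
  "incr_seqs s m = {\<alpha>. length \<alpha> = s \<and> sorted_wrt (<) \<alpha> \<and> set \<alpha> \<subseteq> {0..<m}}"

definition Inj :: "nat set \<Rightarrow> nat set \<Rightarrow> (nat \<Rightarrow> nat) set" where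
  "Inj S T = {\<phi> \<in> S \<rightarrow>\<^sub>E T. inj_on \<phi> S}"

text \<open>Requiring the cycle to lie in \<open>S\<close> keeps all iterates inside the domain of \<open>\<phi>\<close>.\<close>

definition num_cycles :: "nat set \<Rightarrow> (nat \<Rightarrow> nat) \<Rightarrow> nat" where
  "num_cycles S \<phi> =
     card {C. C \<noteq> {} \<and> C \<subseteq> S \<and> (\<exists>j p. C = (\<lambda>i. (\<phi> ^^ i) j) ` {0..<p} \<and> (\<phi> ^^ p) j = j)}"

definition cyc_rook_num :: "nat \<Rightarrow> 'a::comm_ring_1 mat \<Rightarrow> 'a poly" where
  "cyc_rook_num l C =
     (\<Sum>S | S \<subseteq> {0..<dim_row C} \<and> card S = l.
        \<Sum>\<phi>\<in>Inj S {0..<dim_col C}. monom (\<Prod>i\<in>S. C $$ (i, \<phi> i)) (num_cycles S \<phi>))"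

definition cyc_rook_poly :: "'a::comm_ring_1 mat \<Rightarrow> 'a poly poly" where
  "cyc_rook_poly C = (\<Sum>l = 0..dim_row C. monom (cyc_rook_num l C) l)"

definition cyc_per :: "'a::comm_ring_1 mat \<Rightarrow> 'a poly" where
  "cyc_per C = cyc_rook_num (dim_row C) C"

text \<open>
  The permanent of a matrix with at most as many rows as columns.  For a square matrix the
  injections below are exactly the permutations of the index set.
\<close>

definition per :: "'a::comm_ring_1 mat \<Rightarrow> 'a" where
  "per C = (\<Sum>\<phi>\<in>Inj {0..<dim_row C} {0..<dim_col C}. \<Prod>i = 0..<dim_row C. C $$ (i, \<phi> i))"

text \<open>The submatrix with the listed rows and columns, in the listed order.\<close>

definition submat :: "'a mat \<Rightarrow> nat list \<Rightarrow> nat list \<Rightarrow> 'a mat" where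
  "submat C rs cs = mat (length rs) (length cs) (\<lambda>(i, j). C $$ (rs ! i, cs ! j))"

definition delete :: "'a mat \<Rightarrow> nat list \<Rightarrow> nat list \<Rightarrow> 'a mat" where
  "delete C \<alpha> \<beta> =
     submat C (sorted_list_of_set ({0..<dim_row C} - set \<alpha>))
              (sorted_list_of_set ({0..<dim_col C} - set \<beta>))"

definition rook_num :: "nat \<Rightarrow> 'a::comm_ring_1 mat \<Rightarrow> 'a" where
  "rook_num l C =
     (\<Sum>\<alpha>\<in>incr_seqs l (dim_row C). \<Sum>\<beta>\<in>incr_seqs l (dim_col C). per (submat C \<alpha> \<beta>))"

definition rook_poly :: "'a::comm_ring_1 mat \<Rightarrow> 'a poly" where
  "rook_poly C = (\<Sum>l = 0..dim_row C. monom (rook_num l C) l)"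

text \<open>
  For \<open>j \<in> \<phi> ` S - S\<close>, follow \<open>\<phi>\<close> backwards from \<open>j\<close> up to the first element of
  \<open>S - \<phi> ` S\<close>.  All elements met before that one lie in \<open>\<phi> ` S\<close>, so \<open>inv_into\<close> is
  only used where it is the inverse of \<open>\<phi>\<close>.
\<close>

definition phi_star :: "nat set \<Rightarrow> (nat \<Rightarrow> nat) \<Rightarrow> nat \<Rightarrow> nat" where
  "phi_star S \<phi> j =
     (inv_into S \<phi> ^^ (LEAST l. (inv_into S \<phi> ^^ l) j \<in> S - \<phi> ` S)) j"

definition phi_bar :: "nat set \<Rightarrow> (nat \<Rightarrow> nat) \<Rightarrow> 'b list \<Rightarrow> 'b list" where
  "phi_bar S \<phi> xs =
     map (\<lambda>j. if j \<in> \<phi> ` S then xs ! phi_star S \<phi> j else xs ! j)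
         (sorted_list_of_set ({0..<length xs} - S))"

text \<open>The matrix \<open>B[N_m - S | phi_bar(N_n)]\<close> for an \<open>m \<times> n\<close> matrix \<open>B\<close>.\<close>

definition contract :: "nat set \<Rightarrow> (nat \<Rightarrow> nat) \<Rightarrow> 'a mat \<Rightarrow> 'a mat" where
  "contract S \<phi> B =
     submat B (sorted_list_of_set ({0..<dim_row B} - S)) (phi_bar S \<phi> [0..<dim_col B])"

end

theory Submission
  imports Defs
begin

text \<open>
  Expanding every product \<open>\<Prod>i\<in>T. a i (\<theta> i) + b i (\<theta> i)\<close> splits an injection \<open>\<theta>\<close> on \<open>T\<close> into its restrictions
  \<open>\<phi>\<close> to \<open>S\<close> and \<open>\<omega>\<close> to \<open>V = T - S\<close>, where \<open>\<omega>\<close> avoids the columns used by \<open>\<phi>\<close>.  In the ordinary case one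
  then groups the \<open>\<phi>\<close> by their image.  In the cyclic case, following \<open>\<theta>\<close> from a point of \<open>V\<close> until it
  leaves \<open>S\<close> gives the first-return map \<open>\<chi>\<close>, an injection on the contracted matrix.  Deleting the
  points of \<open>S\<close> from the cycles of \<open>\<theta>\<close> that are not contained in \<open>S\<close> yields exactly the cycles of
  \<open>\<chi>\<close>, so the exponents of \<open>z\<close> add up.  The identities for the polynomials and the permanents
  follow from those for the rook numbers.
\<close>

section \<open>Cycles of injections\<close>

text \<open>Finiteness forces two iterates of \<open>x\<close> to coincide. Injectivity on
  \<open>X\<close>, which contains all iterates, cancels their common steps and moves the collision
  back to \<open>x\<close> itself.\<close>

lemma funpow_periodic_point:
  assumes fin: "finite X" and inj: "inj_on f X" and X: "\<And>i. (f ^^ i) x \<in> X"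
  obtains p where "p > 0" "(f ^^ p) x = x"
proof -
  have "\<not> inj (\<lambda>i. (f ^^ i) x)"
    by (meson fin X finite_subset finite_imageD image_subsetI infinite_UNIV_nat)
  then obtain a b where "a < b" and eq: "(f ^^ a) x = (f ^^ b) x"
    unfolding inj_def by (metis nat_neq_iff)
  moreover have "(f ^^ (b - a + i)) x = (f ^^ i) x \<Longrightarrow> (f ^^ (b - a)) x = x" for i
  proof (induction i)
    case (Suc i)
    then have "(f ^^ (b - a + i)) x = (f ^^ i) x"
      using inj_onD[OF inj _ X X] by simp
    then show ?case by (rule Suc.IH)
  qed simp
  from this[of a] have "(f ^^ (b - a)) x = x" using \<open>a < b\<close> eq by simp
  ultimately show ?thesis using that[of "b - a"] by simp
qed

text \<open>Taking all iterates avoids choosing a period; when \<open>x\<close> has a positive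
  period, this is the segment of iterates below it.\<close>

definition forward_orbit :: "('b \<Rightarrow> 'b) \<Rightarrow> 'b \<Rightarrow> 'b set" where
  "forward_orbit f x = range (\<lambda>i. (f ^^ i) x)"

lemma self_in_forward_orbit [simp]: "x \<in> forward_orbit f x"
  unfolding forward_orbit_def by (metis funpow_0 rangeI)

lemma forward_orbit_closed:
  assumes "y \<in> forward_orbit f x"
  shows "f y \<in> forward_orbit f x"
proof -
  obtain i where "y = (f ^^ i) x" using assms by (auto simp: forward_orbit_def)
  then have "f y = (f ^^ Suc i) x" by simp
  then show ?thesis unfolding forward_orbit_def by (rule range_eqI)
qed

lemma funpow_in_forward_orbit: "y \<in> forward_orbit f x \<Longrightarrow> (f ^^ i) y \<in> forward_orbit f x"
  by (induction i) (auto intro: forward_orbit_closed)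

lemma forward_orbit_subset:
  assumes "x \<in> X" and "\<And>y. y \<in> X \<Longrightarrow> y \<in> forward_orbit f x \<Longrightarrow> f y \<in> X"
  shows "forward_orbit f x \<subseteq> X"
proof -
  have "(f ^^ i) x \<in> X" for i
    by (induction i) (use assms in \<open>auto simp: forward_orbit_def\<close>)
  then show ?thesis by (auto simp: forward_orbit_def)
qed

lemma forward_orbit_cong:
  assumes "forward_orbit f x \<subseteq> X" and "\<And>y. y \<in> X \<Longrightarrow> f y = g y"
  shows "forward_orbit g x = forward_orbit f x"
proof -
  have "(f ^^ i) x \<in> X" for i using assms(1) by (auto simp: forward_orbit_def)
  then have "(g ^^ i) x = (f ^^ i) x" for i
    by (induction i) (simp_all flip: assms(2))
  then show ?thesis by (simp add: forward_orbit_def)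
qed

lemma forward_orbit_image:
  assumes "\<And>x. x \<in> forward_orbit f j \<Longrightarrow> g (e x) = e (f x)"
  shows "forward_orbit g (e j) = e ` forward_orbit f j"
proof -
  have "(g ^^ i) (e j) = e ((f ^^ i) j)" for i
    by (induction i) (use assms in \<open>auto simp: forward_orbit_def\<close>)
  then show ?thesis by (auto simp: forward_orbit_def)
qed

text \<open>An orbit inside a finite set on which the map is injective is a cycle, so any of its
  points generates it.\<close>

lemma forward_orbit_eqI:
  assumes fin: "finite X" and inj: "inj_on f X"
    and sub: "forward_orbit f x \<subseteq> X" and y: "y \<in> forward_orbit f x"
  shows "forward_orbit f y = forward_orbit f x"
proof
  show "forward_orbit f y \<subseteq> forward_orbit f x"
    using y by (intro forward_orbit_subset forward_orbit_closed)
  obtain p where p: "p > 0" "(f ^^ p) x = x"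
    using funpow_periodic_point[OF fin inj, of x] sub
    unfolding forward_orbit_def by (metis range_subsetD)
  obtain i where i: "y = (f ^^ i) x" using y by (auto simp: forward_orbit_def)
  \<comment> \<open>Having used \<open>i\<close> steps to get from \<open>x\<close> to
    \<open>y\<close>, another \<open>i * p - i\<close> steps complete \<open>i\<close> full periods;
    \<open>p > 0\<close> makes the truncated subtraction exact.\<close>
  have "(f ^^ (i * p - i)) y = (f ^^ (i * p - i + i)) x"
    by (simp only: i funpow_add o_apply)
  also have "i * p - i + i = i * p" using p(1) by simp
  also have "(f ^^ (i * p)) x = x"
    using funpow_mod_eq[OF p(2), of "i * p"] by simp
  finally have "x \<in> forward_orbit f y"
    by (metis forward_orbit_def rangeI)
  then show "forward_orbit f x \<subseteq> forward_orbit f y"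
    by (intro forward_orbit_subset forward_orbit_closed)
qed

text \<open>Only orbits that stay in \<open>S\<close> are kept, so only the values of
  \<open>f\<close> on \<open>S\<close> matter. For finite \<open>S\<close> and \<open>f\<close>
  injective on \<open>S\<close>, these are the sets counted by \<open>num_cycles\<close>.\<close>

definition cycles :: "'b set \<Rightarrow> ('b \<Rightarrow> 'b) \<Rightarrow> 'b set set" where
  "cycles S f = {C. \<exists>j. C = forward_orbit f j \<and> C \<subseteq> S}"

lemma cycles_subset_Pow: "cycles S f \<subseteq> Pow S"
  by (auto simp: cycles_def)

lemma finite_cycles: "finite S \<Longrightarrow> finite (cycles S f)"
  using cycles_subset_Pow finite_subset by fastforce

lemma cyclesI: "forward_orbit f j \<subseteq> S \<Longrightarrow> forward_orbit f j \<in> cycles S f"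
  by (auto simp: cycles_def)

lemma cycles_eq_forward_orbit:
  assumes "finite S" "inj_on f S" "C \<in> cycles S f" "x \<in> C"
  shows "C = forward_orbit f x"
proof -
  obtain j where "C = forward_orbit f j" "C \<subseteq> S" using assms(3) by (auto simp: cycles_def)
  then show ?thesis using forward_orbit_eqI[OF assms(1,2), of j x] assms(4) by simp
qed

lemma cycles_cong:
  fixes f g :: "'b \<Rightarrow> 'b"
  assumes "\<And>x. x \<in> S \<Longrightarrow> f x = g x"
  shows "cycles S f = cycles S g"
proof -
  have "cycles S f \<subseteq> cycles S g" if "\<And>x. x \<in> S \<Longrightarrow> f x = g x" for f g :: "'b \<Rightarrow> 'b"
  proof
    fix C assume "C \<in> cycles S f"
    then obtain j where j: "C = forward_orbit f j" "C \<subseteq> S" by (auto simp: cycles_def)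
    then have "C = forward_orbit g j" using forward_orbit_cong[of f j S g] that by simp
    then show "C \<in> cycles S g" using j(2) by (auto simp: cycles_def)
  qed
  from this[of f g] this[of g f] show ?thesis using assms by auto
qed

lemma num_cycles_eq_card_cycles:
  assumes fin: "finite S" and inj: "inj_on \<phi> S"
  shows "num_cycles S \<phi> = card (cycles S \<phi>)"
proof -
  have "{C. C \<noteq> {} \<and> C \<subseteq> S \<and> (\<exists>j p. C = (\<lambda>i. (\<phi> ^^ i) j) ` {0..<p} \<and> (\<phi> ^^ p) j = j)}
      = cycles S \<phi>" (is "?L = _")
  proof
    show "?L \<subseteq> cycles S \<phi>"
    proof
      fix C assume "C \<in> ?L"
      then obtain j p where C: "C \<subseteq> S" "C \<noteq> {}"
        and C_eq: "C = (\<lambda>i. (\<phi> ^^ i) j) ` {0..<p}" and p: "(\<phi> ^^ p) j = j" by blast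
      \<comment> \<open>A zero period would give the empty image. With \<open>p > 0\<close>,
        reduction modulo \<open>p\<close> brings every iterate into the listed segment.\<close>
      from C C_eq have "p > 0" by (cases p) auto
      then have "(\<phi> ^^ i) j \<in> C" for i
        unfolding C_eq using funpow_mod_eq[OF p, of i]
        by (auto intro!: image_eqI[of _ _ "i mod p"])
      then have "C = forward_orbit \<phi> j" using C_eq by (auto simp: forward_orbit_def)
      then show "C \<in> cycles S \<phi>" using C by (auto simp: cycles_def)
    qed
    show "cycles S \<phi> \<subseteq> ?L"
    proof
      fix C assume "C \<in> cycles S \<phi>"
      then obtain j where C: "C = forward_orbit \<phi> j" "C \<subseteq> S" by (auto simp: cycles_def)
      obtain p where p: "p > 0" "(\<phi> ^^ p) j = j"
        using funpow_periodic_point[OF fin inj, of j] C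
        unfolding forward_orbit_def by (metis range_subsetD)
      have "C = (\<lambda>i. (\<phi> ^^ i) j) ` {0..<p}"
      proof
        show "C \<subseteq> (\<lambda>i. (\<phi> ^^ i) j) ` {0..<p}"
        proof
          fix y assume "y \<in> C"
          then obtain i where "y = (\<phi> ^^ i) j" using C by (auto simp: forward_orbit_def)
          then show "y \<in> (\<lambda>i. (\<phi> ^^ i) j) ` {0..<p}"
            using funpow_mod_eq[OF p(2), of i] p(1)
            by (auto intro!: image_eqI[of _ _ "i mod p"])
        qed
      qed (auto simp: C forward_orbit_def)
      with p have "\<exists>p. C = (\<lambda>i. (\<phi> ^^ i) j) ` {0..<p} \<and> (\<phi> ^^ p) j = j"
        by (intro exI[of _ p]) simp
      then have "\<exists>j p. C = (\<lambda>i. (\<phi> ^^ i) j) ` {0..<p} \<and> (\<phi> ^^ p) j = j"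
        by (rule exI)
      moreover have "C \<noteq> {}" using C(1) by (auto simp: forward_orbit_def)
      ultimately show "C \<in> ?L" using C(2) by simp
    qed
  qed
  then show ?thesis unfolding num_cycles_def by (rule arg_cong)
qed

lemma num_cycles_cong:
  assumes "finite S" "inj_on \<phi> S" "\<And>i. i \<in> S \<Longrightarrow> \<phi> i = \<psi> i"
  shows "num_cycles S \<phi> = num_cycles S \<psi>"
proof -
  have "inj_on \<psi> S" using assms(2,3) by (simp add: inj_on_def)
  with assms show ?thesis
    by (simp add: num_cycles_eq_card_cycles cycles_cong[of S \<phi> \<psi>])
qed

text \<open>Since \<open>e\<close> conjugates \<psi> to \<chi>, taking images under \<open>e\<close>
  matches their cycles. Injectivity of \<open>e\<close> is asked on the larger set \<open>X\<close>
  because \<psi> may send points of \<open>U\<close> outside \<open>U\<close>.\<close>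

lemma num_cycles_image:
  assumes fin: "finite U" and inj: "inj_on \<psi> U" and e: "inj_on e X"
    and U: "U \<subseteq> X" "\<psi> ` U \<subseteq> X" and comm: "\<And>u. u \<in> U \<Longrightarrow> \<chi> (e u) = e (\<psi> u)"
  shows "num_cycles (e ` U) \<chi> = num_cycles U \<psi>"
proof -
  have eU: "inj_on e U" using e U(1) inj_on_subset by blast
  have inj': "inj_on \<chi> (e ` U)"
  proof (rule inj_onI)
    fix x y assume "x \<in> e ` U" "y \<in> e ` U" "\<chi> x = \<chi> y"
    then obtain u v where uv: "x = e u" "y = e v" "u \<in> U" "v \<in> U" "e (\<psi> u) = e (\<psi> v)"
      using comm by auto
    have "\<psi> u \<in> X" "\<psi> v \<in> X" using U uv by auto
    then have "\<psi> u = \<psi> v" using inj_onD[OF e] uv(5) by blast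
    then show "x = y" using uv inj_onD[OF inj] by auto
  qed
  have "cycles (e ` U) \<chi> = (\<lambda>C. e ` C) ` cycles U \<psi>"
  proof
    show "cycles (e ` U) \<chi> \<subseteq> (\<lambda>C. e ` C) ` cycles U \<psi>"
    proof
      fix C assume "C \<in> cycles (e ` U) \<chi>"
      then obtain j where j: "C = forward_orbit \<chi> j" "C \<subseteq> e ` U" by (auto simp: cycles_def)
      then obtain u where u: "j = e u" "u \<in> U" using self_in_forward_orbit[of j \<chi>] by blast
      \<comment> \<open>The \<chi>-orbit is pulled back step by step: \<open>e (\<psi> v)\<close>
        stays in \<open>C\<close>, hence equals \<open>e w\<close> for some \<open>w\<close> in
        \<open>U\<close>, and injectivity on \<open>X\<close> gives
        \<open>\<psi> v = w\<close>.\<close>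
      have sub: "forward_orbit \<psi> u \<subseteq> {v \<in> U. e v \<in> C}"
      proof (rule forward_orbit_subset)
        show "u \<in> {v \<in> U. e v \<in> C}" using u j by auto
        fix v assume v: "v \<in> {v \<in> U. e v \<in> C}"
        then have "e (\<psi> v) \<in> C" using comm forward_orbit_closed[of _ \<chi> j] j(1) by fastforce
        then obtain w where w: "w \<in> U" "e (\<psi> v) = e w" using j by auto
        have "\<psi> v \<in> X" "w \<in> X" using U v w(1) by auto
        then have "\<psi> v = w" using inj_onD[OF e] w(2) by blast
        with \<open>e (\<psi> v) \<in> C\<close> show "\<psi> v \<in> {v \<in> U. e v \<in> C}" using w by auto
      qed
      then have "C = e ` forward_orbit \<psi> u"
        unfolding j u by (intro forward_orbit_image) (auto simp: comm)
      then show "C \<in> (\<lambda>C. e ` C) ` cycles U \<psi>" using sub by (auto intro!: cyclesI)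
    qed
    show "(\<lambda>C. e ` C) ` cycles U \<psi> \<subseteq> cycles (e ` U) \<chi>"
    proof
      fix D assume "D \<in> (\<lambda>C. e ` C) ` cycles U \<psi>"
      then obtain j where j: "D = e ` forward_orbit \<psi> j" "forward_orbit \<psi> j \<subseteq> U"
        by (auto simp: cycles_def)
      then have "D = forward_orbit \<chi> (e j)"
        by (metis forward_orbit_image comm subsetD)
      then show "D \<in> cycles (e ` U) \<chi>" using j by (auto simp: cycles_def)
    qed
  qed
  moreover have "inj_on (\<lambda>C. e ` C) (cycles U \<psi>)"
    by (rule inj_on_subset[OF inj_on_image_Pow[OF eU] cycles_subset_Pow])
  ultimately show ?thesis
    using fin inj inj' by (simp add: num_cycles_eq_card_cycles card_image)
qed

text \<open>Here \<open>\<chi>\<close> is the first-return map of \<open>\<theta>\<close> to the complement of \<open>S\<close>.  Cycles of \<open>\<theta>\<close> not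
  contained in \<open>S\<close> correspond to cycles of \<open>\<chi>\<close> by removing the points of \<open>S\<close>.\<close>

lemma num_cycles_first_return:
  assumes fin: "finite S" "finite V" and disj: "S \<inter> V = {}"
    and inj: "inj_on \<theta> (S \<union> V)" and inj\<chi>: "inj_on \<chi> V"
    and return: "\<And>v. v \<in> V \<Longrightarrow> \<chi> v \<notin> S \<and>
        (\<exists>k. (\<theta> ^^ k) (\<theta> v) = \<chi> v \<and> (\<forall>i<k. (\<theta> ^^ i) (\<theta> v) \<in> S))"
  shows "num_cycles (S \<union> V) \<theta> = num_cycles S \<theta> + num_cycles V \<chi>"
proof -
  have finT: "finite (S \<union> V)" using fin by simp
  \<comment> \<open>\<open>D\<close> consists of the cycles of \<theta> that meet
    \<open>V\<close>.\<close>
  define D where "D = cycles (S \<union> V) \<theta> - cycles S \<theta>"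
  have sub: "cycles S \<theta> \<subseteq> cycles (S \<union> V) \<theta>" by (auto simp: cycles_def)
  have orbit_minus: "forward_orbit \<theta> j - S = forward_orbit \<chi> j \<and> forward_orbit \<theta> j \<subseteq> S \<union> V"
    if j: "forward_orbit \<chi> j \<subseteq> V" for j
  proof -
    \<comment> \<open>\<open>?W\<close> adds to the \<chi>-orbit the points of \<open>S\<close> from
      which \<theta> reaches it without leaving \<open>S\<close> first. It is closed under \<theta>,
      so the \<theta>-orbit has no points outside \<open>S\<close> other than those of the
      \<chi>-orbit.\<close>
    let ?W = "{y. y \<in> forward_orbit \<chi> j \<or> y \<in> S \<and> (\<exists>k. (\<theta> ^^ k) y \<in> forward_orbit \<chi> j \<and> (\<forall>i<k. (\<theta> ^^ i) y \<in> S))}"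
    have W: "forward_orbit \<theta> j \<subseteq> ?W"
    proof (rule forward_orbit_subset)
      fix y assume "y \<in> ?W"
      then consider "y \<in> forward_orbit \<chi> j"
        | k where "y \<in> S" "(\<theta> ^^ k) y \<in> forward_orbit \<chi> j" "\<forall>i<k. (\<theta> ^^ i) y \<in> S" by auto
      then have "\<exists>k. (\<theta> ^^ k) (\<theta> y) \<in> forward_orbit \<chi> j \<and> (\<forall>i<k. (\<theta> ^^ i) (\<theta> y) \<in> S)"
      proof cases
        case 1
        then have "y \<in> V" "\<chi> y \<in> forward_orbit \<chi> j" using j forward_orbit_closed by auto
        then show ?thesis using return[of y] by metis
      next
        case 2
        \<comment> \<open>Here \<open>k = 0\<close> would put the point \<open>y\<close> of
          \<open>S\<close> on the \<chi>-orbit, which lies in \<open>V\<close>.\<close>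
        then obtain k' where k: "k = Suc k'" using j disj by (cases k) auto
        then have "(\<theta> ^^ k') (\<theta> y) \<in> forward_orbit \<chi> j" using 2 by (simp add: funpow_swap1)
        moreover have "(\<theta> ^^ i) (\<theta> y) \<in> S" if "i < k'" for i
          using 2(3) that k by (metis Suc_mono funpow_Suc_right o_apply)
        ultimately show ?thesis by blast
      qed
      then obtain k where k: "(\<theta> ^^ k) (\<theta> y) \<in> forward_orbit \<chi> j" "\<forall>i<k. (\<theta> ^^ i) (\<theta> y) \<in> S"
        by blast
      then show "\<theta> y \<in> ?W"
      proof (cases k)
        case (Suc k')
        then have "\<theta> y \<in> S" using k(2) by force
        then show ?thesis using k by blast
      qed auto
    qed simp
    have "forward_orbit \<chi> j \<subseteq> forward_orbit \<theta> j"
    proof (rule forward_orbit_subset)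
      fix y assume y: "y \<in> forward_orbit \<theta> j" "y \<in> forward_orbit \<chi> j"
      then have "y \<in> V" using j by auto
      then obtain k where "\<chi> y = (\<theta> ^^ k) (\<theta> y)" using return by metis
      then show "\<chi> y \<in> forward_orbit \<theta> j"
        using funpow_in_forward_orbit[OF forward_orbit_closed[OF y(1)]] by simp
    qed simp
    then show ?thesis using W j disj by blast
  qed
  \<comment> \<open>Conversely, each return stays on the \<theta>-orbit and lands outside
    \<open>S\<close>, hence in \<open>V\<close>.\<close>
  have orbit_return: "forward_orbit \<chi> j \<subseteq> V"
    if j: "forward_orbit \<theta> j \<subseteq> S \<union> V" "j \<notin> S" for j
  proof -
    have "forward_orbit \<chi> j \<subseteq> forward_orbit \<theta> j - S"
    proof (rule forward_orbit_subset)
      fix y assume y: "y \<in> forward_orbit \<theta> j - S"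
      then have v: "y \<in> V" using j by auto
      then obtain k where "\<chi> y = (\<theta> ^^ k) (\<theta> y)" using return by metis
      then show "\<chi> y \<in> forward_orbit \<theta> j - S"
        using funpow_in_forward_orbit[OF forward_orbit_closed, of y \<theta> j] y return[OF v] by simp
    qed (use j in simp)
    then show ?thesis using j by auto
  qed
  have D_gen: "\<exists>j. j \<in> C \<and> j \<notin> S \<and> C = forward_orbit \<theta> j \<and> C - S = forward_orbit \<chi> j \<and> C - S \<subseteq> V"
    if "C \<in> D" for C
  proof -
    have C: "C \<in> cycles (S \<union> V) \<theta>" using that by (simp add: D_def)
    then have CT: "C \<subseteq> S \<union> V" using cycles_subset_Pow by blast
    obtain i where "C = forward_orbit \<theta> i" using C by (auto simp: cycles_def)
    then have "\<not> C \<subseteq> S" using that by (auto simp: D_def cycles_def)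
    then obtain j where j: "j \<in> C" "j \<notin> S" by auto
    then have Cj: "C = forward_orbit \<theta> j" using cycles_eq_forward_orbit[OF finT inj C] by simp
    have "forward_orbit \<chi> j \<subseteq> V" using orbit_return j Cj CT by blast
    then show ?thesis using orbit_minus j Cj by blast
  qed
  have "bij_betw (\<lambda>C. C - S) D (cycles V \<chi>)"
    unfolding bij_betw_def
  proof
    \<comment> \<open>Remainders are nonempty, so two cycles with equal remainders share a point,
      and that point generates both.\<close>
    show "inj_on (\<lambda>C. C - S) D"
    proof (rule inj_onI)
      fix C C' assume C: "C \<in> D" "C' \<in> D" "C - S = C' - S"
      then obtain j where "j \<in> C" "j \<in> C'" using D_gen[OF C(1)] by blast
      then show "C = C'"
        using C cycles_eq_forward_orbit[OF finT inj] unfolding D_def by blast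
    qed
    show "(\<lambda>C. C - S) ` D = cycles V \<chi>"
    proof
      show "(\<lambda>C. C - S) ` D \<subseteq> cycles V \<chi>" 
        using D_gen unfolding cycles_def by blast
      show "cycles V \<chi> \<subseteq> (\<lambda>C. C - S) ` D"
      proof
        fix C assume "C \<in> cycles V \<chi>"
        then obtain j where j: "C = forward_orbit \<chi> j" "C \<subseteq> V" by (auto simp: cycles_def)
        then have "j \<notin> S" using self_in_forward_orbit[of j \<chi>] disj by blast
        then have "forward_orbit \<theta> j \<notin> cycles S \<theta>"
          using cycles_subset_Pow[of S \<theta>] self_in_forward_orbit[of j \<theta>] by blast
        moreover have "forward_orbit \<theta> j \<in> cycles (S \<union> V) \<theta>"
          using orbit_minus[of j] j by (intro cyclesI) simp
        ultimately have "forward_orbit \<theta> j \<in> D" by (simp add: D_def)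
        then show "C \<in> (\<lambda>C. C - S) ` D" using orbit_minus[of j] j by auto
      qed
    qed
  qed
  then have "card D = card (cycles V \<chi>)" by (rule bij_betw_same_card)
  moreover have "card (cycles (S \<union> V) \<theta>) = card (cycles S \<theta>) + card D"
    unfolding D_def using sub finite_cycles[OF finT, of \<theta>]
    by (simp add: card_Diff_subset card_mono finite_subset)
  moreover have "inj_on \<theta> S" using inj by (meson inj_on_Un)
  ultimately show ?thesis
    using fin inj inj\<chi> by (simp add: num_cycles_eq_card_cycles)
qed

section \<open>Sums over injections\<close>

lemma
  assumes "\<phi> \<in> Inj S T"
  shows inj_on_Inj: "inj_on \<phi> S"
    and Inj_in: "i \<in> S \<Longrightarrow> \<phi> i \<in> T"
    and Inj_undefined: "i \<notin> S \<Longrightarrow> \<phi> i = undefined"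
  using assms unfolding Inj_def by (auto elim: PiE_mem PiE_arb)

lemma InjI:
  assumes "inj_on \<phi> S" "\<And>i. i \<in> S \<Longrightarrow> \<phi> i \<in> T" "\<And>i. i \<notin> S \<Longrightarrow> \<phi> i = undefined"
  shows "\<phi> \<in> Inj S T"
  unfolding Inj_def using assms by (intro CollectI conjI PiE_I)

lemma finite_Inj: "finite S \<Longrightarrow> finite T \<Longrightarrow> finite (Inj S T)"
  unfolding Inj_def by (rule finite_subset[OF _ finite_PiE[of S "\<lambda>_. T"]]) auto

text \<open>Conjugation by \<open>e\<close> and \<open>d\<close> matches the two sets of injections.
  Phrasing the condition on the summands through \<open>\<chi> (e u) = d (\<psi> u)\<close> keeps
  inverse maps out of the applications.\<close>

lemma sum_Inj_reindex:
  assumes e: "bij_betw e U V" and d: "bij_betw d X Y"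
    and gh: "\<And>\<psi> \<chi>. \<psi> \<in> Inj U X \<Longrightarrow> \<chi> \<in> Inj V Y \<Longrightarrow> (\<And>u. u \<in> U \<Longrightarrow> \<chi> (e u) = d (\<psi> u)) \<Longrightarrow> g \<psi> = h \<chi>"
  shows "sum g (Inj U X) = sum h (Inj V Y)"
proof -
  \<comment> \<open>Both maps are restricted because members of \<open>Inj\<close> take the value
    \<open>undefined\<close> off their domain.\<close>
  define i where "i = (\<lambda>\<chi>. \<lambda>u\<in>U. inv_into X d (\<chi> (e u)))"
  define j where "j = (\<lambda>\<psi>. \<lambda>v\<in>V. d (\<psi> (inv_into U e v)))"
  have eU: "e u \<in> V" "inv_into U e (e u) = u" if "u \<in> U" for u
    using e that by (auto simp: bij_betw_def)
  have eV: "inv_into U e v \<in> U" "e (inv_into U e v) = v" if "v \<in> V" for v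
    using e that by (auto simp: bij_betw_def inv_into_into f_inv_into_f)
  have dX: "d x \<in> Y" "inv_into X d (d x) = x" if "x \<in> X" for x
    using d that by (auto simp: bij_betw_def)
  have dY: "inv_into X d y \<in> X" "d (inv_into X d y) = y" if "y \<in> Y" for y
    using d that by (auto simp: bij_betw_def inv_into_into f_inv_into_f)
  have jin: "j \<psi> \<in> Inj V Y" if p: "\<psi> \<in> Inj U X" for \<psi>
  proof (rule InjI)
    show "inj_on (j \<psi>) V"
    proof (rule inj_onI)
      fix v w assume vw: "v \<in> V" "w \<in> V" "j \<psi> v = j \<psi> w"
      then have "d (\<psi> (inv_into U e v)) = d (\<psi> (inv_into U e w))" by (simp add: j_def)
      then have "\<psi> (inv_into U e v) = \<psi> (inv_into U e w)"
        using dX(2) Inj_in[OF p] eV(1) vw by metis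
      then have "inv_into U e v = inv_into U e w"
        using inj_onD[OF inj_on_Inj[OF p]] eV(1) vw by metis
      then show "v = w" using eV(2) vw by metis
    qed
  qed (use Inj_in[OF p] eV dX in \<open>auto simp: j_def\<close>)
  have iin: "i \<chi> \<in> Inj U X" if p: "\<chi> \<in> Inj V Y" for \<chi>
  proof (rule InjI)
    show "inj_on (i \<chi>) U"
    proof (rule inj_onI)
      fix v w assume vw: "v \<in> U" "w \<in> U" "i \<chi> v = i \<chi> w"
      then have "inv_into X d (\<chi> (e v)) = inv_into X d (\<chi> (e w))" by (simp add: i_def)
      then have "\<chi> (e v) = \<chi> (e w)"
        using dY(2) Inj_in[OF p] eU(1) vw by metis
      then have "e v = e w"
        using inj_onD[OF inj_on_Inj[OF p]] eU(1) vw by metis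
      then show "v = w" using eU(2) vw by metis
    qed
  qed (use Inj_in[OF p] eU dY in \<open>auto simp: i_def\<close>)
  show ?thesis
  proof (rule sum.reindex_bij_witness[where i = i and j = j])
    fix \<psi> assume p: "\<psi> \<in> Inj U X"
    show "j \<psi> \<in> Inj V Y" using p by (rule jin)
    show "i (j \<psi>) = \<psi>"
      using eU dX Inj_in[OF p] Inj_undefined[OF p] by (auto simp: i_def j_def fun_eq_iff restrict_def)
    show "h (j \<psi>) = g \<psi>"
      using gh[OF p jin[OF p]] eU by (auto simp: j_def)
  next
    fix \<chi> assume p: "\<chi> \<in> Inj V Y"
    show "i \<chi> \<in> Inj U X" using p by (rule iin)
    show "j (i \<chi>) = \<chi>"
      using eV dY Inj_in[OF p] Inj_undefined[OF p] by (auto simp: i_def j_def fun_eq_iff restrict_def)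
  qed
qed

section \<open>Splitting injections and expanding products of sums\<close>

lemma union_Inj:
  assumes disj: "S \<inter> V = {}" and p: "\<phi> \<in> Inj S N" and w: "\<omega> \<in> Inj V (N - \<phi> ` S)"
  shows "(\<lambda>i. if i \<in> S then \<phi> i else \<omega> i) \<in> Inj (S \<union> V) N" (is "?f \<in> _")
proof (rule InjI)
  have "?f ` S = \<phi> ` S" "?f ` V \<subseteq> N - \<phi> ` S"
    using disj Inj_in[OF w] by (auto split: if_splits)
  moreover have "inj_on ?f S" using inj_on_Inj[OF p] by (auto simp: inj_on_def)
  moreover have "inj_on ?f V" using inj_on_Inj[OF w] disj by (auto simp: inj_on_def)
  ultimately show "inj_on ?f (S \<union> V)" unfolding inj_on_Un by blast
qed (use Inj_in[OF p] Inj_in[OF w] Inj_undefined[OF w] in auto)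

text \<open>An injection on \<open>S \<union> V\<close> amounts to \<phi> on \<open>S\<close> and
  \<omega> on \<open>V\<close> avoiding the values of \<phi>; hence the inner index set depends on
  \<phi>.\<close>

lemma sum_Inj_Un:
  assumes "finite S" "finite V" "finite N" and disj: "S \<inter> V = {}"
  shows "sum g (Inj (S \<union> V) N) =
    (\<Sum>\<phi>\<in>Inj S N. \<Sum>\<omega>\<in>Inj V (N - \<phi> ` S). g (\<lambda>i. if i \<in> S then \<phi> i else \<omega> i))"
proof -
  have "(\<Sum>\<phi>\<in>Inj S N. \<Sum>\<omega>\<in>Inj V (N - \<phi> ` S). g (\<lambda>i. if i \<in> S then \<phi> i else \<omega> i)) =
    (\<Sum>(\<phi>, \<omega>)\<in>(SIGMA \<phi>:Inj S N. Inj V (N - \<phi> ` S)). g (\<lambda>i. if i \<in> S then \<phi> i else \<omega> i))"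
    using assms by (subst sum.Sigma) (auto simp: finite_Inj)
  also have "\<dots> = sum g (Inj (S \<union> V) N)"
  proof (rule sum.reindex_bij_witness[where
        j = "\<lambda>(\<phi>, \<omega>) i. if i \<in> S then \<phi> i else \<omega> i" and i = "\<lambda>\<theta>. (restrict \<theta> S, restrict \<theta> V)"])
    fix \<theta> assume t: "\<theta> \<in> Inj (S \<union> V) N"
    show "(case (restrict \<theta> S, restrict \<theta> V) of (\<phi>, \<omega>) \<Rightarrow> \<lambda>i. if i \<in> S then \<phi> i else \<omega> i) = \<theta>"
      using Inj_undefined[OF t] by (auto simp: fun_eq_iff)
    have "restrict \<theta> S \<in> Inj S N"
      using t by (auto simp: Inj_def inj_on_Un inj_on_def)
    moreover have "restrict \<theta> V \<in> Inj V (N - restrict \<theta> S ` S)"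
    proof (rule InjI)
      show "inj_on (restrict \<theta> V) V" using t by (auto simp: Inj_def inj_on_Un inj_on_def)
      fix v assume v: "v \<in> V"
      have "\<theta> v \<noteq> \<theta> s" if "s \<in> S" for s
        using inj_onD[OF inj_on_Inj[OF t], of v s] v that disj by auto
      then show "restrict \<theta> V v \<in> N - restrict \<theta> S ` S" using v Inj_in[OF t, of v] by auto
    qed auto
    ultimately show "(restrict \<theta> S, restrict \<theta> V) \<in> (SIGMA \<phi>:Inj S N. Inj V (N - \<phi> ` S))" by auto
  next
    fix p assume "p \<in> (SIGMA \<phi>:Inj S N. Inj V (N - \<phi> ` S))"
    then obtain \<phi> \<omega> where p: "p = (\<phi>, \<omega>)" "\<phi> \<in> Inj S N" "\<omega> \<in> Inj V (N - \<phi> ` S)" by auto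
    show "(case p of (\<phi>, \<omega>) \<Rightarrow> \<lambda>i. if i \<in> S then \<phi> i else \<omega> i) \<in> Inj (S \<union> V) N"
      using union_Inj[OF disj p(2,3)] p(1) by simp
    show "(restrict (case p of (\<phi>, \<omega>) \<Rightarrow> \<lambda>i. if i \<in> S then \<phi> i else \<omega> i) S,
           restrict (case p of (\<phi>, \<omega>) \<Rightarrow> \<lambda>i. if i \<in> S then \<phi> i else \<omega> i) V) = p"
      using disj Inj_undefined[OF p(2)] Inj_undefined[OF p(3)] p(1)
      by (auto simp: fun_eq_iff restrict_def)
    show "g (case p of (\<phi>, \<omega>) \<Rightarrow> \<lambda>i. if i \<in> S then \<phi> i else \<omega> i) =
      (case p of (\<phi>, \<omega>) \<Rightarrow> g (\<lambda>i. if i \<in> S then \<phi> i else \<omega> i))" using p by simp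
  qed
  finally show ?thesis ..
qed

text \<open>Choosing \<open>T\<close> and then \<open>S\<close> inside it is the same as choosing
  the disjoint sets \<open>S\<close> and \<open>V = T - S\<close>, whose sizes add up to
  \<open>l\<close>.\<close>

lemma sum_disjoint_subset_pairs:
  assumes N: "finite N"
  shows "(\<Sum>T | T \<subseteq> N \<and> card T = l. \<Sum>S\<in>Pow T. F S (T - S)) =
    (\<Sum>s = 0..l. \<Sum>S | S \<subseteq> N \<and> card S = s. \<Sum>V | V \<subseteq> N - S \<and> card V = l - s. F S V)"
proof -
  have fin: "finite T" if "T \<subseteq> N" for T using that N by (rule finite_subset)
  have finC: "finite {S. S \<subseteq> M \<and> card S = k}" if "M \<subseteq> N" for M k
    using fin[OF that] by simp
  let ?L = "SIGMA T:{T. T \<subseteq> N \<and> card T = l}. Pow T"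
  let ?R = "SIGMA s:{0..l}. SIGMA S:{S. S \<subseteq> N \<and> card S = s}. {V. V \<subseteq> N - S \<and> card V = l - s}"
  have "(\<Sum>T | T \<subseteq> N \<and> card T = l. \<Sum>S\<in>Pow T. F S (T - S)) = (\<Sum>(T, S)\<in>?L. F S (T - S))"
    using fin finC by (subst sum.Sigma) auto
  also have "\<dots> = (\<Sum>(s, S, V)\<in>?R. F S V)"
  proof (rule sum.reindex_bij_witness[where j = "\<lambda>(T, S). (card S, S, T - S)"
        and i = "\<lambda>(s, S, V). (S \<union> V, S)"])
    fix q assume "q \<in> ?L"
    then obtain T S where q: "q = (T, S)" "T \<subseteq> N" "card T = l" "S \<subseteq> T" by auto
    then have "card (T - S) = l - card S" "card S \<le> l"
      using fin[of T] fin[of S] card_mono[of T S] by (auto simp: card_Diff_subset)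
    then show "(case q of (T, S) \<Rightarrow> (card S, S, T - S)) \<in> ?R" using q by auto
  next
    fix q assume "q \<in> ?R"
    then obtain s S V where q: "q = (s, S, V)" "s \<le> l" "S \<subseteq> N" "card S = s"
      "V \<subseteq> N - S" "card V = l - s" by auto
    moreover have "finite S" "finite V" using fin q N by (auto intro: finite_subset)
    ultimately have "card (S \<union> V) = l" by (subst card_Un_disjoint) auto
    then show "(case q of (s, S, V) \<Rightarrow> (S \<union> V, S)) \<in> ?L" using q by auto
    show "(case case q of (s, S, V) \<Rightarrow> (S \<union> V, S) of (T, S) \<Rightarrow> (card S, S, T - S)) = q"
      using q by auto
  qed auto
  also have "\<dots> = (\<Sum>s = 0..l. \<Sum>(S, V)\<in>(SIGMA S:{S. S \<subseteq> N \<and> card S = s}. {V. V \<subseteq> N - S \<and> card V = l - s}). F S V)"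
    using finC by (subst sum.Sigma) (auto intro!: finite_SigmaI)
  also have "\<dots> = (\<Sum>s = 0..l. \<Sum>S | S \<subseteq> N \<and> card S = s. \<Sum>V | V \<subseteq> N - S \<and> card V = l - s. F S V)"
    using finC by (intro sum.cong refl, subst sum.Sigma) auto
  finally show ?thesis .
qed

text \<open>\<open>W T \<theta>\<close> attaches the weight \<open>z\<^bsup>|\<theta>|\<^esup>\<close> in the cyclic expansion and nothing in the
  ordinary one.\<close>

lemma sum_Inj_prod_add:
  fixes a b :: "nat \<Rightarrow> nat \<Rightarrow> 'a::comm_semiring_1" and W :: "nat set \<Rightarrow> (nat \<Rightarrow> nat) \<Rightarrow> 'a \<Rightarrow> 'b::comm_monoid_add"
  assumes M: "finite M" and N: "finite N"
    and W: "\<And>T \<theta> f (P :: nat set set). W T \<theta> (sum f P) = (\<Sum>p\<in>P. W T \<theta> (f p))"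
  shows "(\<Sum>T | T \<subseteq> M \<and> card T = l. \<Sum>\<theta>\<in>Inj T N. W T \<theta> (\<Prod>i\<in>T. a i (\<theta> i) + b i (\<theta> i))) =
    (\<Sum>s = 0..l. \<Sum>S | S \<subseteq> M \<and> card S = s. \<Sum>\<phi>\<in>Inj S N.
      \<Sum>V | V \<subseteq> M - S \<and> card V = l - s. \<Sum>\<omega>\<in>Inj V (N - \<phi> ` S).
        W (S \<union> V) (\<lambda>i. if i \<in> S then \<phi> i else \<omega> i) ((\<Prod>i\<in>S. a i (\<phi> i)) * (\<Prod>i\<in>V. b i (\<omega> i))))"
proof -
  \<comment> \<open>\<open>F S V\<close> collects the terms in which the rows in \<open>S\<close>
    contribute entries of \<open>a\<close> and those in \<open>V\<close> entries of
    \<open>b\<close>.\<close>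
  define F where "F = (\<lambda>S V. \<Sum>\<theta>\<in>Inj (S \<union> V) N.
    W (S \<union> V) \<theta> ((\<Prod>i\<in>S. a i (\<theta> i)) * (\<Prod>i\<in>V. b i (\<theta> i))))"
  have fin: "finite T" if "T \<subseteq> M" for T using that M by (rule finite_subset)
  have "(\<Sum>\<theta>\<in>Inj T N. W T \<theta> (\<Prod>i\<in>T. a i (\<theta> i) + b i (\<theta> i))) = (\<Sum>S\<in>Pow T. F S (T - S))"
    if "T \<subseteq> M" for T
  proof -
    have "(\<Sum>\<theta>\<in>Inj T N. W T \<theta> (\<Prod>i\<in>T. a i (\<theta> i) + b i (\<theta> i))) =
      (\<Sum>\<theta>\<in>Inj T N. \<Sum>S\<in>Pow T. W T \<theta> ((\<Prod>i\<in>S. a i (\<theta> i)) * (\<Prod>i\<in>T - S. b i (\<theta> i))))"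
      using fin[OF that] by (simp add: prod_add W)
    also have "\<dots> = (\<Sum>S\<in>Pow T. F S (T - S))"
      unfolding F_def by (subst sum.swap) (auto intro!: sum.cong simp: Un_absorb1)
    finally show ?thesis .
  qed
  then have "(\<Sum>T | T \<subseteq> M \<and> card T = l. \<Sum>\<theta>\<in>Inj T N. W T \<theta> (\<Prod>i\<in>T. a i (\<theta> i) + b i (\<theta> i))) =
    (\<Sum>s = 0..l. \<Sum>S | S \<subseteq> M \<and> card S = s. \<Sum>V | V \<subseteq> M - S \<and> card V = l - s. F S V)"
    using sum_disjoint_subset_pairs[OF M, of F l] by simp
  also have "\<dots> = (\<Sum>s = 0..l. \<Sum>S | S \<subseteq> M \<and> card S = s. \<Sum>V | V \<subseteq> M - S \<and> card V = l - s.
      \<Sum>\<phi>\<in>Inj S N. \<Sum>\<omega>\<in>Inj V (N - \<phi> ` S).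
        W (S \<union> V) (\<lambda>i. if i \<in> S then \<phi> i else \<omega> i) ((\<Prod>i\<in>S. a i (\<phi> i)) * (\<Prod>i\<in>V. b i (\<omega> i))))"
  proof (intro sum.cong refl)
    fix s S V assume "S \<in> {S. S \<subseteq> M \<and> card S = s}" and "V \<in> {V. V \<subseteq> M - S \<and> card V = l - s}"
    then have SV: "finite S" "finite V" "S \<inter> V = {}" using fin[of S] fin[of V] by auto
    have "(\<Prod>i\<in>V. b i (if i \<in> S then \<phi> i else \<omega> i)) = (\<Prod>i\<in>V. b i (\<omega> i))" for \<phi> \<omega> :: "nat \<Rightarrow> nat"
      using SV by (intro prod.cong) auto
    then show "F S V = (\<Sum>\<phi>\<in>Inj S N. \<Sum>\<omega>\<in>Inj V (N - \<phi> ` S).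
        W (S \<union> V) (\<lambda>i. if i \<in> S then \<phi> i else \<omega> i) ((\<Prod>i\<in>S. a i (\<phi> i)) * (\<Prod>i\<in>V. b i (\<omega> i))))"
      unfolding F_def by (subst sum_Inj_Un[OF SV(1,2) N SV(3)]) simp
  qed
  \<comment> \<open>With \<phi> outside, the sums over \<open>V\<close> and \<omega> for fixed
    \<open>S\<close> and \<phi> can be recognized as a rook number of what remains of
    \<open>b\<close>.\<close>
  also have "\<dots> = (\<Sum>s = 0..l. \<Sum>S | S \<subseteq> M \<and> card S = s. \<Sum>\<phi>\<in>Inj S N.
      \<Sum>V | V \<subseteq> M - S \<and> card V = l - s. \<Sum>\<omega>\<in>Inj V (N - \<phi> ` S).
        W (S \<union> V) (\<lambda>i. if i \<in> S then \<phi> i else \<omega> i) ((\<Prod>i\<in>S. a i (\<phi> i)) * (\<Prod>i\<in>V. b i (\<omega> i))))"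
    by (intro sum.cong refl sum.swap)
  finally show ?thesis .
qed

section \<open>Subsets, increasing sequences and submatrices\<close>

lemma sum_subsets_reindex:
  assumes "bij_betw e X Y"
  shows "(\<Sum>V | V \<subseteq> Y \<and> card V = k. h V) = (\<Sum>U | U \<subseteq> X \<and> card U = k. h (e ` U))"
proof -
  have inj: "inj_on e X" and Y: "Y = e ` X" using assms by (auto simp: bij_betw_def)
  have card: "card (e ` U) = card U" if "U \<subseteq> X" for U
    using inj that by (meson card_image inj_on_subset)
  have "{V. V \<subseteq> Y \<and> card V = k} = (\<lambda>U. e ` U) ` {U. U \<subseteq> X \<and> card U = k}"
    unfolding Y by (auto simp: subset_image_iff card)
  moreover have "inj_on (\<lambda>U. e ` U) {U. U \<subseteq> X \<and> card U = k}"
    by (rule inj_on_subset[OF inj_on_image_Pow[OF inj]]) auto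
  ultimately show ?thesis by (simp add: sum.reindex)
qed

lemma set_incr_seqs:
  assumes "\<alpha> \<in> incr_seqs s m"
  shows "set \<alpha> \<subseteq> {0..<m}" "card (set \<alpha>) = s" "distinct \<alpha>"
  using assms by (auto simp: incr_seqs_def strict_sorted_iff distinct_card)

text \<open>A strictly increasing list is determined by its set of entries, and
  \<open>sorted_list_of_set\<close> recovers it.\<close>

lemma sum_incr_seqs:
  "(\<Sum>\<alpha>\<in>incr_seqs s m. h (set \<alpha>)) = (\<Sum>S | S \<subseteq> {0..<m} \<and> card S = s. h S)"
proof (rule sum.reindex_bij_witness[where j = set and i = sorted_list_of_set])
  fix \<alpha> assume a: "\<alpha> \<in> incr_seqs s m"
  show "sorted_list_of_set (set \<alpha>) = \<alpha>"
    using a sorted_list_of_set_unique[of "set \<alpha>" \<alpha>] set_incr_seqs[OF a] by (auto simp: incr_seqs_def)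
  show "set \<alpha> \<in> {S. S \<subseteq> {0..<m} \<and> card S = s}" using set_incr_seqs[OF a] by auto
next
  fix S assume S: "S \<in> {S. S \<subseteq> {0..<m} \<and> card S = s}"
  then have "finite S" using finite_subset by blast
  then show "set (sorted_list_of_set S) = S" "sorted_list_of_set S \<in> incr_seqs s m"
    using S by (auto simp: incr_seqs_def)
qed simp

text \<open>Positions in the lists are replaced by the original indices, so that the permanent
  becomes a sum over injections between sets. Distinctness makes \<open>(!)\<close> a
  bijection.\<close>

lemma per_submat:
  assumes "distinct rs" "distinct cs"
  shows "per (submat C rs cs) = (\<Sum>\<phi>\<in>Inj (set rs) (set cs). \<Prod>i\<in>set rs. C $$ (i, \<phi> i))"
proof -
  have rs: "bij_betw ((!) rs) {0..<length rs} (set rs)"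
    by (rule bij_betw_nth[OF assms(1)]) auto
  have cs: "bij_betw ((!) cs) {0..<length cs} (set cs)"
    by (rule bij_betw_nth[OF assms(2)]) auto
  have "per (submat C rs cs) = (\<Sum>\<psi>\<in>Inj {0..<length rs} {0..<length cs}.
      \<Prod>i = 0..<length rs. submat C rs cs $$ (i, \<psi> i))"
    by (simp add: per_def submat_def)
  also have "\<dots> = (\<Sum>\<phi>\<in>Inj (set rs) (set cs). \<Prod>i\<in>set rs. C $$ (i, \<phi> i))"
  proof (rule sum_Inj_reindex[OF rs cs])
    fix \<psi> \<chi> assume p: "\<psi> \<in> Inj {0..<length rs} {0..<length cs}"
      and c: "\<And>u. u \<in> {0..<length rs} \<Longrightarrow> \<chi> (rs ! u) = cs ! \<psi> u"
    have "(\<Prod>i\<in>set rs. C $$ (i, \<chi> i)) = (\<Prod>i = 0..<length rs. C $$ (rs ! i, \<chi> (rs ! i)))"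
      using rs by (rule prod.reindex_bij_betw[symmetric])
    also have "\<dots> = (\<Prod>i = 0..<length rs. submat C rs cs $$ (i, \<psi> i))"
      using Inj_in[OF p] by (intro prod.cong) (auto simp: submat_def c)
    finally show "(\<Prod>i = 0..<length rs. submat C rs cs $$ (i, \<psi> i)) = (\<Prod>i\<in>set rs. C $$ (i, \<chi> i))" ..
  qed
  finally show ?thesis .
qed

lemma Inj_image_eq:
  assumes \<phi>: "\<phi> \<in> Inj S T" and T: "finite T" "card T = card S"
  shows "\<phi> ` S = T"
proof (rule card_subset_eq[OF T(1)])
  show "\<phi> ` S \<subseteq> T" using Inj_in[OF \<phi>] by auto
  show "card (\<phi> ` S) = card T" using T(2) card_image[OF inj_on_Inj[OF \<phi>]] by simp
qed

text \<open>An injection into a set of the size of its domain is onto, so these sums group the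
  injections into \<open>N\<close> by their image.\<close>

lemma sum_Inj_by_image:
  assumes S: "finite S" and N: "finite N"
  shows "(\<Sum>T | T \<subseteq> N \<and> card T = card S. sum g (Inj S T)) = sum g (Inj S N)"
proof -
  have "Inj S T = {\<phi> \<in> Inj S N. \<phi> ` S = T}" if T: "T \<subseteq> N" "card T = card S" for T
  proof -
    have "\<phi> ` S = T" if "\<phi> \<in> Inj S T" for \<phi>
      using Inj_image_eq[OF that] T finite_subset[OF T(1) N] by simp
    then show ?thesis using T by (auto simp: Inj_def PiE_def Pi_def)
  qed
  then have "(\<Sum>T | T \<subseteq> N \<and> card T = card S. sum g (Inj S T)) =
      (\<Sum>T | T \<subseteq> N \<and> card T = card S. sum g {\<phi>. \<phi> \<in> Inj S N \<and> \<phi> ` S = T})"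
    by (intro sum.cong) auto
  also have "\<dots> = sum g (Inj S N)"
  proof (rule sum.group)
    show "(\<lambda>\<phi>. \<phi> ` S) ` Inj S N \<subseteq> {T. T \<subseteq> N \<and> card T = card S}"
      by (auto simp: card_image inj_on_Inj Inj_in)
  qed (use assms finite_Inj in auto)
  finally show ?thesis .
qed

text \<open>Each injection belongs to exactly one column set, its image, which absorbs the sum over
  column sequences. The result has the shape of \<open>cyc_rook_num\<close> without the powers of
  \<open>z\<close>.\<close>

lemma rook_num_eq_sum_Inj:
  "rook_num l C = (\<Sum>S | S \<subseteq> {0..<dim_row C} \<and> card S = l.
     \<Sum>\<phi>\<in>Inj S {0..<dim_col C}. \<Prod>i\<in>S. C $$ (i, \<phi> i))"
proof -
  have "rook_num l C = (\<Sum>\<alpha>\<in>incr_seqs l (dim_row C). \<Sum>\<beta>\<in>incr_seqs l (dim_col C).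
      \<Sum>\<phi>\<in>Inj (set \<alpha>) (set \<beta>). \<Prod>i\<in>set \<alpha>. C $$ (i, \<phi> i))"
    unfolding rook_num_def by (intro sum.cong refl per_submat) (auto dest: set_incr_seqs)
  also have "\<dots> = (\<Sum>S | S \<subseteq> {0..<dim_row C} \<and> card S = l. \<Sum>T | T \<subseteq> {0..<dim_col C} \<and> card T = l.
      \<Sum>\<phi>\<in>Inj S T. \<Prod>i\<in>S. C $$ (i, \<phi> i))"
    by (simp add: sum_incr_seqs[of "\<lambda>T. \<Sum>\<phi>\<in>Inj _ T. _ \<phi>"]
        sum_incr_seqs[of "\<lambda>S. \<Sum>T | T \<subseteq> {0..<dim_col C} \<and> card T = l. \<Sum>\<phi>\<in>Inj S T. \<Prod>i\<in>S. C $$ (i, \<phi> i)"])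
  also have "\<dots> = (\<Sum>S | S \<subseteq> {0..<dim_row C} \<and> card S = l.
     \<Sum>\<phi>\<in>Inj S {0..<dim_col C}. \<Prod>i\<in>S. C $$ (i, \<phi> i))"
  proof (intro sum.cong refl)
    fix S assume "S \<in> {S. S \<subseteq> {0..<dim_row C} \<and> card S = l}"
    then have "finite S" "card S = l" using finite_subset by auto
    then show "(\<Sum>T | T \<subseteq> {0..<dim_col C} \<and> card T = l. \<Sum>\<phi>\<in>Inj S T. \<Prod>i\<in>S. C $$ (i, \<phi> i)) =
      (\<Sum>\<phi>\<in>Inj S {0..<dim_col C}. \<Prod>i\<in>S. C $$ (i, \<phi> i))"
      using sum_Inj_by_image[of S "{0..<dim_col C}"] by simp
  qed
  finally show ?thesis .
qed

text \<open>The only full-size set of rows is the whole row set, so permanent identities can be read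
  off from those for rook numbers.\<close>

lemma per_eq_rook_num: "per C = rook_num (dim_row C) C"
proof -
  have "{S. S \<subseteq> {0..<dim_row C} \<and> card S = dim_row C} = {{0..<dim_row C}}"
    using card_subset_eq[of "{0..<dim_row C}"] by auto
  then show ?thesis by (simp add: per_def rook_num_eq_sum_Inj)
qed

lemma rook_num_submat:
  assumes "distinct rs" "distinct cs"
  shows "rook_num k (submat C rs cs) =
    (\<Sum>V | V \<subseteq> set rs \<and> card V = k. \<Sum>\<phi>\<in>Inj V (set cs). \<Prod>i\<in>V. C $$ (i, \<phi> i))"
proof -
  have rs: "bij_betw ((!) rs) {0..<length rs} (set rs)"
    by (rule bij_betw_nth[OF assms(1)]) auto
  have cs: "bij_betw ((!) cs) {0..<length cs} (set cs)"
    by (rule bij_betw_nth[OF assms(2)]) auto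
  have "rook_num k (submat C rs cs) = (\<Sum>U | U \<subseteq> {0..<length rs} \<and> card U = k.
      \<Sum>\<psi>\<in>Inj U {0..<length cs}. \<Prod>i\<in>U. submat C rs cs $$ (i, \<psi> i))"
    by (simp add: rook_num_eq_sum_Inj) (simp add: submat_def)
  also have "\<dots> = (\<Sum>U | U \<subseteq> {0..<length rs} \<and> card U = k.
      \<Sum>\<phi>\<in>Inj ((!) rs ` U) (set cs). \<Prod>i\<in>(!) rs ` U. C $$ (i, \<phi> i))"
  proof (rule sum.cong[OF refl])
    fix U assume "U \<in> {U. U \<subseteq> {0..<length rs} \<and> card U = k}"
    then have U: "U \<subseteq> {0..<length rs}" by simp
    then have bij: "bij_betw ((!) rs) U ((!) rs ` U)"
      using rs by (meson bij_betw_imageI bij_betw_imp_inj_on inj_on_subset)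
    show "(\<Sum>\<psi>\<in>Inj U {0..<length cs}. \<Prod>i\<in>U. submat C rs cs $$ (i, \<psi> i)) =
      (\<Sum>\<phi>\<in>Inj ((!) rs ` U) (set cs). \<Prod>i\<in>(!) rs ` U. C $$ (i, \<phi> i))"
    proof (rule sum_Inj_reindex[OF bij cs])
      fix \<psi> \<chi> assume p: "\<psi> \<in> Inj U {0..<length cs}"
        and c: "\<And>u. u \<in> U \<Longrightarrow> \<chi> (rs ! u) = cs ! \<psi> u"
      have "(\<Prod>i\<in>(!) rs ` U. C $$ (i, \<chi> i)) = (\<Prod>i\<in>U. C $$ (rs ! i, \<chi> (rs ! i)))"
        using bij by (rule prod.reindex_bij_betw[symmetric])
      also have "\<dots> = (\<Prod>i\<in>U. submat C rs cs $$ (i, \<psi> i))"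
        using Inj_in[OF p] U by (intro prod.cong) (auto simp: submat_def c)
      finally show "(\<Prod>i\<in>U. submat C rs cs $$ (i, \<psi> i)) = (\<Prod>i\<in>(!) rs ` U. C $$ (i, \<chi> i))" ..
    qed
  qed
  also have "\<dots> = (\<Sum>V | V \<subseteq> set rs \<and> card V = k. \<Sum>\<phi>\<in>Inj V (set cs). \<Prod>i\<in>V. C $$ (i, \<phi> i))"
    using sum_subsets_reindex[OF rs] by (rule sym)
  finally show ?thesis .
qed

section \<open>Contraction along an injection\<close>

text \<open>The backward walk from \<open>j\<close> must stop: otherwise it would stay in the finite
  image of \<phi>, where the inverse is injective, and hence return to \<open>j\<close>. Running
  \<phi> forward retraces the walk.\<close>

lemma phi_star_trace:
  assumes fin: "finite S" and inj: "inj_on \<phi> S" and j: "j \<in> \<phi> ` S" "j \<notin> S"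
  shows "phi_star S \<phi> j \<in> S - \<phi> ` S"
    and "\<exists>k. (\<phi> ^^ k) (phi_star S \<phi> j) = j \<and> (\<forall>i<k. (\<phi> ^^ i) (phi_star S \<phi> j) \<in> S)"
proof -
  let ?g = "inv_into S \<phi>"
  have g: "?g x \<in> S" "\<phi> (?g x) = x" if "x \<in> \<phi> ` S" for x
    using that by (auto simp: inv_into_into f_inv_into_f)
  \<comment> \<open>A backward step lands in \<open>S\<close>; as long as it misses the stopping
    set, it is again in the image of \<phi>, so the next step is defined.\<close>
  have stay: "(?g ^^ i) j \<in> \<phi> ` S" if "\<And>i'. i' \<le> i \<Longrightarrow> (?g ^^ i') j \<notin> S - \<phi> ` S" for i
    using that
  proof (induction i)
    case (Suc i)
    then have "(?g ^^ i) j \<in> \<phi> ` S" by simp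
    then have "(?g ^^ Suc i) j \<in> S" using g by simp
    then show ?case using Suc.prems[of "Suc i"] by blast
  qed (use j in simp)
  have ex: "\<exists>l. (?g ^^ l) j \<in> S - \<phi> ` S"
  proof (rule ccontr)
    assume "\<not> ?thesis"
    then have all: "(?g ^^ i) j \<in> \<phi> ` S" for i using stay by blast
    obtain p where p: "p > 0" "(?g ^^ p) j = j"
      by (rule funpow_periodic_point[of "\<phi> ` S" ?g j]) (use fin all in \<open>auto intro: inj_on_inv_into\<close>)
    then obtain q where "p = Suc q" by (cases p) auto
    \<comment> \<open>A periodic \<open>j\<close> would be a value of the inverse map and thus lie
      in \<open>S\<close>.\<close>
    then have "j = ?g ((?g ^^ q) j)" using p(2) by simp
    then show False using g(1)[OF all[of q]] j(2) by simp
  qed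
  define l where "l = (LEAST l. (?g ^^ l) j \<in> S - \<phi> ` S)"
  have star: "phi_star S \<phi> j = (?g ^^ l) j" by (simp add: phi_star_def l_def)
  show "phi_star S \<phi> j \<in> S - \<phi> ` S" unfolding star l_def using ex by (rule LeastI_ex)
  have before: "(?g ^^ i) j \<in> \<phi> ` S" if "i < l" for i
    using that not_less_Least[of _ "\<lambda>l. (?g ^^ l) j \<in> S - \<phi> ` S"] unfolding l_def
    by (intro stay) (meson le_less_trans)
  have trace: "(\<phi> ^^ i) ((?g ^^ l) j) = (?g ^^ (l - i)) j" if "i \<le> l" for i
    using that
  proof (induction i)
    case (Suc i)
    then have "l - i = Suc (l - Suc i)" by simp
    then have "(\<phi> ^^ Suc i) ((?g ^^ l) j) = \<phi> (?g ((?g ^^ (l - Suc i)) j))"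
      using Suc by simp
    also have "\<dots> = (?g ^^ (l - Suc i)) j" using Suc.prems by (intro g before) simp
    finally show ?case .
  qed simp
  have "(\<phi> ^^ i) ((?g ^^ l) j) \<in> S" if "i < l" for i
  proof -
    \<comment> \<open>Every point before the end \<open>j\<close> is itself a value of the inverse
      map; \<open>i < l\<close> keeps \<open>l - i\<close> positive.\<close>
    have "(\<phi> ^^ i) ((?g ^^ l) j) = ?g ((?g ^^ (l - Suc i)) j)"
      using trace[of i] that by (simp flip: funpow.simps(2) o_apply[of ?g] add: Suc_diff_Suc)
    then show ?thesis using g(1) before[of "l - Suc i"] that by simp
  qed
  then show "\<exists>k. (\<phi> ^^ k) (phi_star S \<phi> j) = j \<and> (\<forall>i<k. (\<phi> ^^ i) (phi_star S \<phi> j) \<in> S)"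
    using trace[of l] unfolding star by (intro exI[of _ l]) simp
qed

text \<open>The arrows of \<phi> form cycles and paths. For \<open>j\<close> outside
  \<open>S\<close> this is the first point of the path ending at \<open>j\<close>, a trivial path if
  \<open>j\<close> is not a value of \<phi>; it merges the two cases of
  \<open>phi_bar\<close>.\<close>

definition chain_start :: "nat set \<Rightarrow> (nat \<Rightarrow> nat) \<Rightarrow> nat \<Rightarrow> nat" where
  "chain_start S \<phi> j = (if j \<in> \<phi> ` S then phi_star S \<phi> j else j)"

lemma
  assumes "finite S" "inj_on \<phi> S" "j \<notin> S"
  shows chain_start_notin: "chain_start S \<phi> j \<notin> \<phi> ` S"
    and chain_start_in: "chain_start S \<phi> j \<in> insert j S"
    and chain_start_trace: "\<exists>k. (\<phi> ^^ k) (chain_start S \<phi> j) = j \<and>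
      (\<forall>i<k. (\<phi> ^^ i) (chain_start S \<phi> j) \<in> S)"
proof -
  show "chain_start S \<phi> j \<notin> \<phi> ` S" "chain_start S \<phi> j \<in> insert j S"
    using phi_star_trace(1)[OF assms(1,2) _ assms(3)] by (auto simp: chain_start_def)
  show "\<exists>k. (\<phi> ^^ k) (chain_start S \<phi> j) = j \<and> (\<forall>i<k. (\<phi> ^^ i) (chain_start S \<phi> j) \<in> S)"
  proof (cases "j \<in> \<phi> ` S")
    case True
    then show ?thesis using phi_star_trace(2)[OF assms(1,2) _ assms(3)] by (simp add: chain_start_def)
  next
    case False
    then show ?thesis by (auto simp: chain_start_def intro!: exI[of _ 0])
  qed
qed

text \<open>Following \<phi> from a start until it leaves \<open>S\<close> recovers the end of the
  path, which gives injectivity; surjectivity follows by counting, as \<phi> preserves the size of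
  \<open>S\<close>.\<close>

lemma bij_betw_chain_start:
  assumes N: "finite N" and S: "S \<subseteq> N" and p: "\<phi> \<in> Inj S N"
  shows "bij_betw (chain_start S \<phi>) (N - S) (N - \<phi> ` S)"
proof -
  have fin: "finite S" using S N by (rule finite_subset)
  note inj = inj_on_Inj[OF p]
  have pS: "\<phi> ` S \<subseteq> N" using Inj_in[OF p] by auto
  have inj': "inj_on (chain_start S \<phi>) (N - S)"
  proof (rule inj_onI)
    fix x y assume xy: "x \<in> N - S" "y \<in> N - S" "chain_start S \<phi> x = chain_start S \<phi> y"
    obtain k where k: "(\<phi> ^^ k) (chain_start S \<phi> x) = x"
      "\<And>i. i < k \<Longrightarrow> (\<phi> ^^ i) (chain_start S \<phi> x) \<in> S"
      using chain_start_trace[OF fin inj, of x] xy(1) by blast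
    obtain k' where k': "(\<phi> ^^ k') (chain_start S \<phi> y) = y"
      "\<And>i. i < k' \<Longrightarrow> (\<phi> ^^ i) (chain_start S \<phi> y) \<in> S"
      using chain_start_trace[OF fin inj, of y] xy(2) by blast
    \<comment> \<open>The shorter trace would end outside \<open>S\<close> at a point that the
      longer one still keeps in \<open>S\<close>.\<close>
    have "\<not> k < k'" "\<not> k' < k" using k(1) k'(1) k(2)[of k'] k'(2)[of k] xy by auto
    then have "k = k'" by simp
    then have "(\<phi> ^^ k) (chain_start S \<phi> x) = (\<phi> ^^ k') (chain_start S \<phi> y)"
      by (simp only: xy(3))
    then show "x = y" unfolding k(1) k'(1) .
  qed
  have "chain_start S \<phi> ` (N - S) = N - \<phi> ` S"
  proof (rule card_subset_eq)
    show "chain_start S \<phi> ` (N - S) \<subseteq> N - \<phi> ` S"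
    proof
      fix y assume "y \<in> chain_start S \<phi> ` (N - S)"
      then obtain x where x: "y = chain_start S \<phi> x" "x \<in> N" "x \<notin> S" by auto
      then show "y \<in> N - \<phi> ` S"
        using chain_start_notin[OF fin inj x(3)] chain_start_in[OF fin inj x(3)] S by auto
    qed
    show "card (chain_start S \<phi> ` (N - S)) = card (N - \<phi> ` S)"
      using fin S pS by (simp add: card_image inj' inj card_Diff_subset)
  qed (use N in simp)
  with inj' show ?thesis by (simp add: bij_betw_def)
qed

text \<open>The maps \<open>\<omega> = chain_start S \<phi> \<circ> \<chi>\<close> and \<open>\<chi>\<close> determine each other, and \<open>\<chi>\<close> is the first-return
  map of \<open>\<phi> \<union> \<omega>\<close> to the complement of \<open>S\<close>.\<close>

lemma sum_monom_num_cycles_chain_start: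
  assumes N: "finite N" and S: "S \<subseteq> N" and V: "V \<subseteq> N - S" and p: "\<phi> \<in> Inj S N"
  shows "monom c (num_cycles S \<phi>) *
      (\<Sum>\<chi>\<in>Inj V (N - S). monom (\<Prod>i\<in>V. b i (chain_start S \<phi> (\<chi> i))) (num_cycles V \<chi>)) =
    (\<Sum>\<omega>\<in>Inj V (N - \<phi> ` S). monom (c * (\<Prod>i\<in>V. b i (\<omega> i) :: 'a::comm_semiring_1))
      (num_cycles (S \<union> V) (\<lambda>i. if i \<in> S then \<phi> i else \<omega> i)))"
  unfolding sum_distrib_left mult_monom
proof (rule sum_Inj_reindex[of "\<lambda>i. i" _ _ "chain_start S \<phi>"])
  show "bij_betw (\<lambda>i. i) V V" by (simp add: bij_betw_def)
  show "bij_betw (chain_start S \<phi>) (N - S) (N - \<phi> ` S)" using N S p by (rule bij_betw_chain_start)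
  fix \<chi> \<omega>
  assume c: "\<chi> \<in> Inj V (N - S)" and w: "\<omega> \<in> Inj V (N - \<phi> ` S)"
    and cw: "\<And>u. u \<in> V \<Longrightarrow> \<omega> u = chain_start S \<phi> (\<chi> u)"
  let ?t = "\<lambda>i. if i \<in> S then \<phi> i else \<omega> i"
  have fin: "finite S" "finite V" and disj: "S \<inter> V = {}"
    using finite_subset[OF S N] finite_subset[OF V] N V by auto
  note inj = inj_on_Inj[OF p]
  have "num_cycles (S \<union> V) ?t = num_cycles S ?t + num_cycles V \<chi>"
  proof (rule num_cycles_first_return[OF fin disj])
    show "inj_on ?t (S \<union> V)" using union_Inj[OF disj p w] by (rule inj_on_Inj)
    show "inj_on \<chi> V" using c by (rule inj_on_Inj)
    fix v assume v: "v \<in> V"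
    have out: "\<chi> v \<notin> S" using Inj_in[OF c v] by simp
    obtain k where k: "(\<phi> ^^ k) (\<omega> v) = \<chi> v" "\<And>i. i < k \<Longrightarrow> (\<phi> ^^ i) (\<omega> v) \<in> S"
      using chain_start_trace[OF fin(1) inj out] cw[OF v] by auto
    have "?t v = \<omega> v" using v disj by auto
    \<comment> \<open>All points before step \<open>k\<close> lie in \<open>S\<close>, where the
      combined map agrees with \<phi>.\<close>
    moreover have "(?t ^^ i) (\<omega> v) = (\<phi> ^^ i) (\<omega> v)" if "i \<le> k" for i
      using that by (induction i) (simp_all add: k(2))
    ultimately show "\<chi> v \<notin> S \<and> (\<exists>k. (?t ^^ k) (?t v) = \<chi> v \<and> (\<forall>i<k. (?t ^^ i) (?t v) \<in> S))"
      using out k by (intro conjI exI[of _ k]) (auto simp: less_imp_le)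
  qed
  moreover have "num_cycles S ?t = num_cycles S \<phi>"
    using num_cycles_cong[OF fin(1) inj, of ?t] by simp
  ultimately show "monom (c * (\<Prod>i\<in>V. b i (chain_start S \<phi> (\<chi> i)))) (num_cycles S \<phi> + num_cycles V \<chi>) =
    monom (c * (\<Prod>i\<in>V. b i (\<omega> i))) (num_cycles (S \<union> V) ?t)"
    by (simp add: cw)
qed

text \<open>\<open>S\<close> removes only indices below \<open>m\<close>, so the remaining rows are
  an initial segment of the remaining columns. Row \<open>i\<close> and column \<open>i\<close> of
  the contracted matrix thus carry the same original label.\<close>

lemma sorted_list_of_set_Diff_prefix:
  assumes "S \<subseteq> {0..<m}" "m \<le> (n::nat)"
  shows "sorted_list_of_set ({0..<n} - S) = sorted_list_of_set ({0..<m} - S) @ [m..<n]"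
proof -
  have "sorted_wrt (<) (sorted_list_of_set ({0..<m} - S) @ [m..<n])"
    by (auto simp: sorted_wrt_append)
  moreover have "set (sorted_list_of_set ({0..<m} - S) @ [m..<n]) = {0..<n} - S"
    using assms by auto
  ultimately show ?thesis
    by (metis strict_sorted_equal finite_Diff finite_atLeastLessThan
        sorted_list_of_set.set_sorted_key_list_of_set strict_sorted_list_of_set)
qed

lemma dim_contract:
  "B \<in> carrier_mat m n \<Longrightarrow> S \<subseteq> {0..<m} \<Longrightarrow> dim_row (contract S \<phi> B) = m - card S"
  "B \<in> carrier_mat m n \<Longrightarrow> S \<subseteq> {0..<n} \<Longrightarrow> dim_col (contract S \<phi> B) = n - card S"
  by (auto simp: contract_def submat_def phi_bar_def card_Diff_subset finite_subset)

text \<open>Position \<open>j\<close> carries the label \<open>e j\<close>, but its column is taken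
  from \<open>chain_start S \<phi> (e j)\<close> in \<open>B\<close>. The cycle count uses the
  labels, the entries use the starts.\<close>

lemma contract_index:
  assumes B: "B \<in> carrier_mat m n" and mn: "m \<le> n" and S: "S \<subseteq> {0..<m}" and inj: "inj_on \<phi> S"
    and i: "i < m - card S" and j: "j < n - card S"
  defines "e \<equiv> (!) (sorted_list_of_set ({0..<n} - S))"
  shows "contract S \<phi> B $$ (i, j) = B $$ (e i, chain_start S \<phi> (e j))"
proof -
  have fin: "finite S" using S finite_subset by blast
  have Sn: "S \<subseteq> {0..<n}" using S mn by auto
  have len: "length (sorted_list_of_set ({0..<m} - S)) = m - card S"
    "length (sorted_list_of_set ({0..<n} - S)) = n - card S"
    using fin S Sn by (simp_all add: card_Diff_subset)
  have row: "sorted_list_of_set ({0..<m} - S) ! i = e i"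
    unfolding e_def sorted_list_of_set_Diff_prefix[OF S mn] using i len by (simp add: nth_append)
  have "e j \<in> {0..<n} - S"
    unfolding e_def using nth_mem[of j "sorted_list_of_set ({0..<n} - S)"] j len by simp
  then have "chain_start S \<phi> (e j) < n" "e j < n"
    using chain_start_in[OF fin inj, of "e j"] Sn by auto
  moreover have "phi_bar S \<phi> [0..<n] ! j =
      (if e j \<in> \<phi> ` S then [0..<n] ! phi_star S \<phi> (e j) else [0..<n] ! e j)"
    using j len unfolding phi_bar_def e_def by simp
  ultimately have "phi_bar S \<phi> [0..<n] ! j = chain_start S \<phi> (e j)"
    by (auto simp: chain_start_def)
  moreover have "length (phi_bar S \<phi> [0..<n]) = n - card S" using len by (simp add: phi_bar_def)
  ultimately show ?thesis using B i j len row by (simp add: contract_def submat_def)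
qed

lemma cyc_rook_num_contract:
  assumes B: "B \<in> carrier_mat m n" and mn: "m \<le> n" and S: "S \<subseteq> {0..<m}" and inj: "inj_on \<phi> S"
  shows "cyc_rook_num k (contract S \<phi> B) =
    (\<Sum>V | V \<subseteq> {0..<m} - S \<and> card V = k. \<Sum>\<chi>\<in>Inj V ({0..<n} - S).
      monom (\<Prod>i\<in>V. B $$ (i, chain_start S \<phi> (\<chi> i))) (num_cycles V \<chi>))"
proof -
  have fin: "finite S" using S finite_subset by blast
  have Sn: "S \<subseteq> {0..<n}" using S mn by auto
  define e where "e = (!) (sorted_list_of_set ({0..<n} - S))"
  have cols: "bij_betw e {0..<n - card S} ({0..<n} - S)"
    unfolding e_def by (rule bij_betw_nth) (use fin Sn in \<open>auto simp: card_Diff_subset\<close>)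
  have "bij_betw ((!) (sorted_list_of_set ({0..<m} - S))) {0..<m - card S} ({0..<m} - S)"
    by (rule bij_betw_nth) (use fin S in \<open>auto simp: card_Diff_subset\<close>)
  moreover have "sorted_list_of_set ({0..<m} - S) ! i = e i" if "i \<in> {0..<m - card S}" for i
    unfolding e_def sorted_list_of_set_Diff_prefix[OF S mn] using that fin S
    by (simp add: nth_append card_Diff_subset)
  \<comment> \<open>One numbering \<open>e\<close> serves rows and columns alike, so that
    \<open>e\<close> conjugates \<psi> to \<chi> and preserves the number of cycles.\<close>
  ultimately have rows: "bij_betw e {0..<m - card S} ({0..<m} - S)"
    using bij_betw_cong by blast
  have "cyc_rook_num k (contract S \<phi> B) = (\<Sum>U | U \<subseteq> {0..<m - card S} \<and> card U = k.
      \<Sum>\<psi>\<in>Inj U {0..<n - card S}. monom (\<Prod>i\<in>U. contract S \<phi> B $$ (i, \<psi> i)) (num_cycles U \<psi>))"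
    by (simp add: cyc_rook_num_def dim_contract[OF B] S Sn)
  also have "\<dots> = (\<Sum>U | U \<subseteq> {0..<m - card S} \<and> card U = k. \<Sum>\<chi>\<in>Inj (e ` U) ({0..<n} - S).
      monom (\<Prod>i\<in>e ` U. B $$ (i, chain_start S \<phi> (\<chi> i))) (num_cycles (e ` U) \<chi>))"
  proof (rule sum.cong[OF refl])
    fix U assume "U \<in> {U. U \<subseteq> {0..<m - card S} \<and> card U = k}"
    then have U: "U \<subseteq> {0..<m - card S}" by simp
    then have bij: "bij_betw e U (e ` U)"
      using rows by (meson bij_betw_imageI bij_betw_imp_inj_on inj_on_subset)
    show "(\<Sum>\<psi>\<in>Inj U {0..<n - card S}. monom (\<Prod>i\<in>U. contract S \<phi> B $$ (i, \<psi> i)) (num_cycles U \<psi>)) =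
      (\<Sum>\<chi>\<in>Inj (e ` U) ({0..<n} - S).
        monom (\<Prod>i\<in>e ` U. B $$ (i, chain_start S \<phi> (\<chi> i))) (num_cycles (e ` U) \<chi>))"
    proof (rule sum_Inj_reindex[OF bij cols])
      fix \<psi> \<chi> assume p: "\<psi> \<in> Inj U {0..<n - card S}" and c: "\<And>u. u \<in> U \<Longrightarrow> \<chi> (e u) = e (\<psi> u)"
      have "(\<Prod>i\<in>e ` U. B $$ (i, chain_start S \<phi> (\<chi> i))) =
          (\<Prod>i\<in>U. B $$ (e i, chain_start S \<phi> (\<chi> (e i))))"
        using bij by (rule prod.reindex_bij_betw[symmetric])
      also have "\<dots> = (\<Prod>i\<in>U. contract S \<phi> B $$ (i, \<psi> i))"
      proof (rule prod.cong[OF refl])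
        fix i assume i: "i \<in> U"
        have "i < m - card S" "\<psi> i < n - card S" using i U Inj_in[OF p i] by auto
        then show "B $$ (e i, chain_start S \<phi> (\<chi> (e i))) = contract S \<phi> B $$ (i, \<psi> i)"
          using contract_index[OF B mn S inj] c[OF i] by (simp add: e_def)
      qed
      finally have "(\<Prod>i\<in>e ` U. B $$ (i, chain_start S \<phi> (\<chi> i))) = \<dots>" .
      moreover have "num_cycles (e ` U) \<chi> = num_cycles U \<psi>"
      proof (rule num_cycles_image[OF _ inj_on_Inj[OF p] bij_betw_imp_inj_on[OF cols]])
        show "finite U" using U finite_subset by blast
        show "U \<subseteq> {0..<n - card S}" using U mn by fastforce
        show "\<psi> ` U \<subseteq> {0..<n - card S}" using Inj_in[OF p] by blast
      qed (rule c)
      ultimately show "monom (\<Prod>i\<in>U. contract S \<phi> B $$ (i, \<psi> i)) (num_cycles U \<psi>) =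
        monom (\<Prod>i\<in>e ` U. B $$ (i, chain_start S \<phi> (\<chi> i))) (num_cycles (e ` U) \<chi>)" by simp
    qed
  qed
  also have "\<dots> = (\<Sum>V | V \<subseteq> {0..<m} - S \<and> card V = k. \<Sum>\<chi>\<in>Inj V ({0..<n} - S).
      monom (\<Prod>i\<in>V. B $$ (i, chain_start S \<phi> (\<chi> i))) (num_cycles V \<chi>))"
    using sum_subsets_reindex[OF rows] by (rule sym)
  finally show ?thesis .
qed

section \<open>Expansion of rook numbers\<close>

text \<open>After the expansion, substituting
  \<open>\<omega> = chain_start S \<phi> \<circ> \<chi>\<close> separates the cycles inside
  \<open>S\<close> from the others, and the factor left is the rook number of the
  contraction.\<close>

lemma cyc_rook_num_add:
  assumes A: "A \<in> carrier_mat m n" and B: "B \<in> carrier_mat m n" and mn: "m \<le> n"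
  shows "cyc_rook_num l (A + B) =
    (\<Sum>s = 0..l. \<Sum>\<alpha>\<in>incr_seqs s m. \<Sum>\<phi>\<in>Inj (set \<alpha>) {0..<n}.
      monom (\<Prod>i\<in>set \<alpha>. A $$ (i, \<phi> i)) (num_cycles (set \<alpha>) \<phi>)
        * cyc_rook_num (l - s) (contract (set \<alpha>) \<phi> B))"
proof -
  have "cyc_rook_num l (A + B) = (\<Sum>T | T \<subseteq> {0..<m} \<and> card T = l. \<Sum>\<theta>\<in>Inj T {0..<n}.
      monom (\<Prod>i\<in>T. A $$ (i, \<theta> i) + B $$ (i, \<theta> i)) (num_cycles T \<theta>))"
    unfolding cyc_rook_num_def
  proof (rule sum.cong, use B in simp, rule sum.cong, use B in simp)
    fix T \<theta> assume T: "T \<in> {T. T \<subseteq> {0..<m} \<and> card T = l}" and t: "\<theta> \<in> Inj T {0..<n}"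
    have "(\<Prod>i\<in>T. (A + B) $$ (i, \<theta> i)) = (\<Prod>i\<in>T. A $$ (i, \<theta> i) + B $$ (i, \<theta> i))"
      using A B T Inj_in[OF t] by (intro prod.cong) auto
    then show "monom (\<Prod>i\<in>T. (A + B) $$ (i, \<theta> i)) (num_cycles T \<theta>) =
      monom (\<Prod>i\<in>T. A $$ (i, \<theta> i) + B $$ (i, \<theta> i)) (num_cycles T \<theta>)" by simp
  qed
  also have "\<dots> = (\<Sum>s = 0..l. \<Sum>S | S \<subseteq> {0..<m} \<and> card S = s. \<Sum>\<phi>\<in>Inj S {0..<n}.
      \<Sum>V | V \<subseteq> {0..<m} - S \<and> card V = l - s. \<Sum>\<omega>\<in>Inj V ({0..<n} - \<phi> ` S).
        monom ((\<Prod>i\<in>S. A $$ (i, \<phi> i)) * (\<Prod>i\<in>V. B $$ (i, \<omega> i)))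
          (num_cycles (S \<union> V) (\<lambda>i. if i \<in> S then \<phi> i else \<omega> i)))"
    by (rule sum_Inj_prod_add[where W = "\<lambda>T \<theta> c. monom c (num_cycles T \<theta>)"]) (simp_all add: monom_sum)
  also have "\<dots> = (\<Sum>s = 0..l. \<Sum>S | S \<subseteq> {0..<m} \<and> card S = s. \<Sum>\<phi>\<in>Inj S {0..<n}.
      monom (\<Prod>i\<in>S. A $$ (i, \<phi> i)) (num_cycles S \<phi>) * cyc_rook_num (l - s) (contract S \<phi> B))"
  proof (rule sum.cong[OF refl], rule sum.cong[OF refl], rule sum.cong[OF refl])
    fix s S \<phi> assume "S \<in> {S. S \<subseteq> {0..<m} \<and> card S = s}" and p: "\<phi> \<in> Inj S {0..<n}"
    then have S: "S \<subseteq> {0..<m}" "S \<subseteq> {0..<n}" using mn by auto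
    have "(\<Sum>\<omega>\<in>Inj V ({0..<n} - \<phi> ` S).
        monom ((\<Prod>i\<in>S. A $$ (i, \<phi> i)) * (\<Prod>i\<in>V. B $$ (i, \<omega> i)))
          (num_cycles (S \<union> V) (\<lambda>i. if i \<in> S then \<phi> i else \<omega> i))) =
      monom (\<Prod>i\<in>S. A $$ (i, \<phi> i)) (num_cycles S \<phi>) * (\<Sum>\<chi>\<in>Inj V ({0..<n} - S).
        monom (\<Prod>i\<in>V. B $$ (i, chain_start S \<phi> (\<chi> i))) (num_cycles V \<chi>))"
      if "V \<subseteq> {0..<m} - S" for V
      by (rule sum_monom_num_cycles_chain_start[symmetric]) (use S p mn that in auto)
    then show "(\<Sum>V | V \<subseteq> {0..<m} - S \<and> card V = l - s. \<Sum>\<omega>\<in>Inj V ({0..<n} - \<phi> ` S).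
        monom ((\<Prod>i\<in>S. A $$ (i, \<phi> i)) * (\<Prod>i\<in>V. B $$ (i, \<omega> i)))
          (num_cycles (S \<union> V) (\<lambda>i. if i \<in> S then \<phi> i else \<omega> i))) =
      monom (\<Prod>i\<in>S. A $$ (i, \<phi> i)) (num_cycles S \<phi>) * cyc_rook_num (l - s) (contract S \<phi> B)"
      \<comment> \<open>The instance with \<open>Collect _\<close> distributes the factor over the
        sum on \<open>V\<close> only and leaves the sum on \<chi> intact.\<close>
      unfolding cyc_rook_num_contract[OF B mn S(1) inj_on_Inj[OF p]] sum_distrib_left[of _ _ "Collect _"]
      by (intro sum.cong refl) simp
  qed
  also have "\<dots> = (\<Sum>s = 0..l. \<Sum>\<alpha>\<in>incr_seqs s m. \<Sum>\<phi>\<in>Inj (set \<alpha>) {0..<n}.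
      monom (\<Prod>i\<in>set \<alpha>. A $$ (i, \<phi> i)) (num_cycles (set \<alpha>) \<phi>)
        * cyc_rook_num (l - s) (contract (set \<alpha>) \<phi> B))"
    by (intro sum.cong refl sum_incr_seqs[symmetric])
  finally show ?thesis .
qed

lemma rook_num_add:
  assumes A: "A \<in> carrier_mat m n" and B: "B \<in> carrier_mat m n"
  shows "rook_num l (A + B) =
    (\<Sum>s = 0..l. \<Sum>\<alpha>\<in>incr_seqs s m. \<Sum>\<beta>\<in>incr_seqs s n.
      per (submat A \<alpha> \<beta>) * rook_num (l - s) (delete B \<alpha> \<beta>))"
proof -
  \<comment> \<open>This is the rook number of \<open>B\<close> without rows \<open>S\<close> and
    columns \<open>T\<close>, in original indices. It sees \<phi> only through its image, which
    permits grouping by image.\<close>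
  define r where "r = (\<lambda>k S T. \<Sum>V | V \<subseteq> {0..<m} - S \<and> card V = k.
    \<Sum>\<omega>\<in>Inj V ({0..<n} - T). \<Prod>i\<in>V. B $$ (i, \<omega> i))"
  have "rook_num l (A + B) = (\<Sum>T | T \<subseteq> {0..<m} \<and> card T = l. \<Sum>\<theta>\<in>Inj T {0..<n}.
      \<Prod>i\<in>T. A $$ (i, \<theta> i) + B $$ (i, \<theta> i))"
    unfolding rook_num_eq_sum_Inj
  proof (rule sum.cong, use B in simp, rule sum.cong, use B in simp)
    fix T \<theta> assume T: "T \<in> {T. T \<subseteq> {0..<m} \<and> card T = l}" and t: "\<theta> \<in> Inj T {0..<n}"
    show "(\<Prod>i\<in>T. (A + B) $$ (i, \<theta> i)) = (\<Prod>i\<in>T. A $$ (i, \<theta> i) + B $$ (i, \<theta> i))"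
      using A B T Inj_in[OF t] by (intro prod.cong) auto
  qed
  also have "\<dots> = (\<Sum>s = 0..l. \<Sum>S | S \<subseteq> {0..<m} \<and> card S = s. \<Sum>\<phi>\<in>Inj S {0..<n}.
      (\<Prod>i\<in>S. A $$ (i, \<phi> i)) * r (l - s) S (\<phi> ` S))"
    using sum_Inj_prod_add[where W = "\<lambda>_ _ c. c" and M = "{0..<m}" and N = "{0..<n}" and l = l
        and a = "\<lambda>i j. A $$ (i, j)" and b = "\<lambda>i j. B $$ (i, j)"]
    by (simp add: r_def sum_distrib_left)
  also have "\<dots> = (\<Sum>s = 0..l. \<Sum>S | S \<subseteq> {0..<m} \<and> card S = s. \<Sum>T | T \<subseteq> {0..<n} \<and> card T = s.
      (\<Sum>\<phi>\<in>Inj S T. \<Prod>i\<in>S. A $$ (i, \<phi> i)) * r (l - s) S T)"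
  proof (rule sum.cong[OF refl], rule sum.cong[OF refl])
    fix s S assume S: "S \<in> {S. S \<subseteq> {0..<m} \<and> card S = s}"
    then have fin: "finite S" using finite_subset by blast
    have "\<phi> ` S = T" if "T \<subseteq> {0..<n}" "card T = s" "\<phi> \<in> Inj S T" for \<phi> T
      using Inj_image_eq[OF that(3)] finite_subset[OF that(1)] that(2) S by simp
    then have "(\<Sum>T | T \<subseteq> {0..<n} \<and> card T = s. (\<Sum>\<phi>\<in>Inj S T. \<Prod>i\<in>S. A $$ (i, \<phi> i)) * r (l - s) S T) =
      (\<Sum>T | T \<subseteq> {0..<n} \<and> card T = s. \<Sum>\<phi>\<in>Inj S T. (\<Prod>i\<in>S. A $$ (i, \<phi> i)) * r (l - s) S (\<phi> ` S))"
      unfolding sum_distrib_right by (intro sum.cong refl) auto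
    also have "\<dots> = (\<Sum>\<phi>\<in>Inj S {0..<n}. (\<Prod>i\<in>S. A $$ (i, \<phi> i)) * r (l - s) S (\<phi> ` S))"
      using sum_Inj_by_image[OF fin, of "{0..<n}"] S by simp
    finally show "(\<Sum>\<phi>\<in>Inj S {0..<n}. (\<Prod>i\<in>S. A $$ (i, \<phi> i)) * r (l - s) S (\<phi> ` S)) =
      (\<Sum>T | T \<subseteq> {0..<n} \<and> card T = s. (\<Sum>\<phi>\<in>Inj S T. \<Prod>i\<in>S. A $$ (i, \<phi> i)) * r (l - s) S T)" ..
  qed
  also have "\<dots> = (\<Sum>s = 0..l. \<Sum>\<alpha>\<in>incr_seqs s m. \<Sum>\<beta>\<in>incr_seqs s n.
      (\<Sum>\<phi>\<in>Inj (set \<alpha>) (set \<beta>). \<Prod>i\<in>set \<alpha>. A $$ (i, \<phi> i)) * r (l - s) (set \<alpha>) (set \<beta>))"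
  proof (rule sum.cong[OF refl])
    fix s
    let ?f = "\<lambda>S T. (\<Sum>\<phi>\<in>Inj S T. \<Prod>i\<in>S. A $$ (i, \<phi> i)) * r (l - s) S T"
    have "(\<Sum>\<alpha>\<in>incr_seqs s m. \<Sum>\<beta>\<in>incr_seqs s n. ?f (set \<alpha>) (set \<beta>)) =
        (\<Sum>\<alpha>\<in>incr_seqs s m. \<Sum>T | T \<subseteq> {0..<n} \<and> card T = s. ?f (set \<alpha>) T)"
      by (rule sum.cong[OF refl], rule sum_incr_seqs)
    also have "\<dots> = (\<Sum>S | S \<subseteq> {0..<m} \<and> card S = s. \<Sum>T | T \<subseteq> {0..<n} \<and> card T = s. ?f S T)"
      by (rule sum_incr_seqs)
    finally show "(\<Sum>S | S \<subseteq> {0..<m} \<and> card S = s. \<Sum>T | T \<subseteq> {0..<n} \<and> card T = s. ?f S T) =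
      (\<Sum>\<alpha>\<in>incr_seqs s m. \<Sum>\<beta>\<in>incr_seqs s n. ?f (set \<alpha>) (set \<beta>))" ..
  qed
  also have "\<dots> = (\<Sum>s = 0..l. \<Sum>\<alpha>\<in>incr_seqs s m. \<Sum>\<beta>\<in>incr_seqs s n.
      per (submat A \<alpha> \<beta>) * rook_num (l - s) (delete B \<alpha> \<beta>))"
  proof (rule sum.cong[OF refl], rule sum.cong[OF refl], rule sum.cong[OF refl])
    fix s \<alpha> \<beta> assume "\<alpha> \<in> incr_seqs s m" "\<beta> \<in> incr_seqs s n"
    then have "distinct \<alpha>" "distinct \<beta>" by (auto dest: set_incr_seqs)
    then show "(\<Sum>\<phi>\<in>Inj (set \<alpha>) (set \<beta>). \<Prod>i\<in>set \<alpha>. A $$ (i, \<phi> i)) * r (l - s) (set \<alpha>) (set \<beta>) =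
      per (submat A \<alpha> \<beta>) * rook_num (l - s) (delete B \<alpha> \<beta>)"
      using B by (simp add: per_submat delete_def rook_num_submat r_def)
  qed
  finally show ?thesis .
qed

section \<open>From rook numbers to generating polynomials and permanents\<close>

lemma dim_row_delete:
  assumes "B \<in> carrier_mat m n" "\<alpha> \<in> incr_seqs s m"
  shows "dim_row (delete B \<alpha> \<beta>) = m - s"
  using assms set_incr_seqs[OF assms(2)] by (simp add: delete_def submat_def card_Diff_subset)

text \<open>A Cauchy product with truncation: the bound \<open>m - s\<close> on the inner sum is the
  number of rows left after removing \<open>s\<close> of \<open>m\<close>.\<close>

lemma monom_sum_convolution:
  "(\<Sum>l = 0..m. monom (\<Sum>s = 0..l. \<Sum>\<alpha>\<in>I s. \<Sum>\<phi>\<in>J s \<alpha>. c s \<alpha> \<phi> * r (l - s) \<alpha> \<phi>) l) =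
    (\<Sum>s = 0..m. \<Sum>\<alpha>\<in>I s. \<Sum>\<phi>\<in>J s \<alpha>.
      monom (c s \<alpha> \<phi> :: 'a::comm_semiring_1) s * (\<Sum>k = 0..m - s. monom (r k \<alpha> \<phi>) k))"
proof -
  define g where "g = (\<lambda>s k. \<Sum>\<alpha>\<in>I s. \<Sum>\<phi>\<in>J s \<alpha>. c s \<alpha> \<phi> * r k \<alpha> \<phi>)"
  have "(\<Sum>l = 0..m. monom (\<Sum>s = 0..l. \<Sum>\<alpha>\<in>I s. \<Sum>\<phi>\<in>J s \<alpha>. c s \<alpha> \<phi> * r (l - s) \<alpha> \<phi>) l) =
      (\<Sum>(l, s)\<in>(SIGMA l:{0..m}. {0..l}). monom (g s (l - s)) l)"
    by (subst sum.Sigma[symmetric]) (simp_all add: g_def monom_sum)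
  \<comment> \<open>With \<open>k = l - s\<close>, the triangle \<open>s \<le> l \<le> m\<close>
    becomes \<open>k \<le> m - s\<close>.\<close>
  also have "\<dots> = (\<Sum>(s, k)\<in>(SIGMA s:{0..m}. {0..m - s}). monom (g s k) (s + k))"
    by (rule sum.reindex_bij_witness[where i = "\<lambda>(s, k). (s + k, s)" and j = "\<lambda>(l, s). (s, l - s)"]) auto
  also have "\<dots> = (\<Sum>s = 0..m. \<Sum>k = 0..m - s. monom (g s k) (s + k))"
    by (subst sum.Sigma) simp_all
  also have "\<dots> = (\<Sum>s = 0..m. \<Sum>\<alpha>\<in>I s. \<Sum>\<phi>\<in>J s \<alpha>.
      monom (c s \<alpha> \<phi>) s * (\<Sum>k = 0..m - s. monom (r k \<alpha> \<phi>) k))"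
  proof (rule sum.cong[OF refl])
    fix s
    have "(\<Sum>k = 0..m - s. monom (g s k) (s + k)) =
      (\<Sum>k = 0..m - s. \<Sum>\<alpha>\<in>I s. \<Sum>\<phi>\<in>J s \<alpha>. monom (c s \<alpha> \<phi>) s * monom (r k \<alpha> \<phi>) k)"
      by (simp add: g_def monom_sum mult_monom)
    also have "\<dots> = (\<Sum>\<alpha>\<in>I s. \<Sum>k = 0..m - s. \<Sum>\<phi>\<in>J s \<alpha>. monom (c s \<alpha> \<phi>) s * monom (r k \<alpha> \<phi>) k)"
      by (rule sum.swap)
    also have "\<dots> = (\<Sum>\<alpha>\<in>I s. \<Sum>\<phi>\<in>J s \<alpha>. \<Sum>k = 0..m - s. monom (c s \<alpha> \<phi>) s * monom (r k \<alpha> \<phi>) k)"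
      by (rule sum.cong[OF refl], rule sum.swap)
    finally show "(\<Sum>k = 0..m - s. monom (g s k) (s + k)) =
      (\<Sum>\<alpha>\<in>I s. \<Sum>\<phi>\<in>J s \<alpha>. monom (c s \<alpha> \<phi>) s * (\<Sum>k = 0..m - s. monom (r k \<alpha> \<phi>) k))"
      by (simp add: sum_distrib_left)
  qed
  finally show ?thesis .
qed

theorem theorem5:
  fixes A B :: "'a::comm_ring_1 mat" and m n :: nat
  assumes "A \<in> carrier_mat m n" and "B \<in> carrier_mat m n" and "m \<le> n"
  shows
    "(cyc_rook_poly (A + B) =
       (\<Sum>s = 0..m. \<Sum>\<alpha>\<in>incr_seqs s m. \<Sum>\<phi>\<in>Inj (set \<alpha>) {0..<n}.
          monom (monom (\<Prod>i\<in>set \<alpha>. A $$ (i, \<phi> i)) (num_cycles (set \<alpha>) \<phi>)) s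
            * cyc_rook_poly (contract (set \<alpha>) \<phi> B)))
     \<and> (\<forall>l\<le>m. cyc_rook_num l (A + B) =
       (\<Sum>s = 0..l. \<Sum>\<alpha>\<in>incr_seqs s m. \<Sum>\<phi>\<in>Inj (set \<alpha>) {0..<n}.
          monom (\<Prod>i\<in>set \<alpha>. A $$ (i, \<phi> i)) (num_cycles (set \<alpha>) \<phi>)
            * cyc_rook_num (l - s) (contract (set \<alpha>) \<phi> B)))
     \<and> (cyc_per (A + B) =
       (\<Sum>s = 0..m. \<Sum>\<alpha>\<in>incr_seqs s m. \<Sum>\<phi>\<in>Inj (set \<alpha>) {0..<n}.
          monom (\<Prod>i\<in>set \<alpha>. A $$ (i, \<phi> i)) (num_cycles (set \<alpha>) \<phi>)
            * cyc_per (contract (set \<alpha>) \<phi> B)))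
     \<and> (rook_poly (A + B) =
       (\<Sum>s = 0..m. \<Sum>\<alpha>\<in>incr_seqs s m. \<Sum>\<beta>\<in>incr_seqs s n.
          monom (per (submat A \<alpha> \<beta>)) s * rook_poly (delete B \<alpha> \<beta>)))
     \<and> (\<forall>l\<le>m. rook_num l (A + B) =
       (\<Sum>s = 0..l. \<Sum>\<alpha>\<in>incr_seqs s m. \<Sum>\<beta>\<in>incr_seqs s n.
          per (submat A \<alpha> \<beta>) * rook_num (l - s) (delete B \<alpha> \<beta>)))
     \<and> (per (A + B) =
       (\<Sum>s = 0..m. \<Sum>\<alpha>\<in>incr_seqs s m. \<Sum>\<beta>\<in>incr_seqs s n.
          per (submat A \<alpha> \<beta>) * per (delete B \<alpha> \<beta>)))"
proof -
  note B = assms(2)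
  note cyc = cyc_rook_num_add[OF assms]
  note ord = rook_num_add[OF assms(1,2)]
  have dim: "dim_row (A + B) = m" using B by simp
  \<comment> \<open>The remaining matrix has \<open>m - s\<close> rows: the bound in the convolution
    and, for \<open>l = m\<close>, the index at which its rook number is its permanent.\<close>
  have dimc: "dim_row (contract (set \<alpha>) \<phi> B) = m - s" if "\<alpha> \<in> incr_seqs s m" for s \<alpha> \<phi>
    using dim_contract(1)[OF B] set_incr_seqs[OF that] by simp
  note dimd = dim_row_delete[OF B]
  have "cyc_rook_poly (A + B) =
       (\<Sum>s = 0..m. \<Sum>\<alpha>\<in>incr_seqs s m. \<Sum>\<phi>\<in>Inj (set \<alpha>) {0..<n}.
          monom (monom (\<Prod>i\<in>set \<alpha>. A $$ (i, \<phi> i)) (num_cycles (set \<alpha>) \<phi>)) s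
            * cyc_rook_poly (contract (set \<alpha>) \<phi> B))"
    unfolding cyc_rook_poly_def dim cyc
    by (subst monom_sum_convolution[where r = "\<lambda>k \<alpha> \<phi>. cyc_rook_num k (contract (set \<alpha>) \<phi> B)"], rule sum.cong[OF refl], rule sum.cong[OF refl], rule sum.cong[OF refl]) (simp add: dimc)
  moreover have "cyc_per (A + B) =
       (\<Sum>s = 0..m. \<Sum>\<alpha>\<in>incr_seqs s m. \<Sum>\<phi>\<in>Inj (set \<alpha>) {0..<n}.
          monom (\<Prod>i\<in>set \<alpha>. A $$ (i, \<phi> i)) (num_cycles (set \<alpha>) \<phi>)
            * cyc_per (contract (set \<alpha>) \<phi> B))"
    unfolding cyc_per_def dim cyc
    by (rule sum.cong[OF refl], rule sum.cong[OF refl], rule sum.cong[OF refl]) (simp add: dimc)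
  moreover have "rook_poly (A + B) =
       (\<Sum>s = 0..m. \<Sum>\<alpha>\<in>incr_seqs s m. \<Sum>\<beta>\<in>incr_seqs s n.
          monom (per (submat A \<alpha> \<beta>)) s * rook_poly (delete B \<alpha> \<beta>))"
    unfolding rook_poly_def dim ord
    by (subst monom_sum_convolution[where r = "\<lambda>k \<alpha> \<phi>. rook_num k (delete B \<alpha> \<phi>)"], rule sum.cong[OF refl], rule sum.cong[OF refl], rule sum.cong[OF refl]) (simp add: dimd)
  moreover have "per (A + B) =
       (\<Sum>s = 0..m. \<Sum>\<alpha>\<in>incr_seqs s m. \<Sum>\<beta>\<in>incr_seqs s n.
          per (submat A \<alpha> \<beta>) * per (delete B \<alpha> \<beta>))"
    unfolding per_eq_rook_num[of "A + B"] dim ord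
    by (rule sum.cong[OF refl], rule sum.cong[OF refl], rule sum.cong[OF refl])
      (simp add: dimd per_eq_rook_num[of "delete B _ _"])
  ultimately show ?thesis using cyc ord by blast
qed

end
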